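(* Let $T$ be the left-invariant $(0,2)$-tensor field on $G$ given by $T=-T_{\mathfrak p}Q|_{\mathfrak p}+T_1Q|_{\mathfrak k_1}+\cdots+T_{r+s}Q|_{\mathfrak k_{r+s}}$ with $T_{\mathfrak p},T_1,\dots,T_{r+s}>0$. A metric $g\in\mathcal M_K$ with $\mathrm{Ric}(g)=T$ exists if and only if $4T_i-\kappa_i>0$ for all $i=1,\dots,r$ and $$T_{\mathfrak p}=\sum_{i=1}^{r+s}\frac{2d_i(1-\kappa_i)+d_i\sqrt{(4T_i-\kappa_i)(1-\kappa_i)}}{2n}.$$ Moreover, there is at most one such $g$ up to scaling.
   Context: Let $G$ be a connected non-compact simple Lie group with Lie algebra $\mathfrak g$, $K$ a maximal compact subgroup with Lie algebra $\mathfrak k$, $B$ the Killing form of $\mathfrak g$, and $\mathfrak p$ the $B$-orthogonal complement of $\mathfrak k$ in $\mathfrak g$. Let $Q=B|_{\mathfrak p}-B|_{\mathfrak k}$. Write $\mathfrak k=\mathfrak k_1\oplus\cdots\oplus\mathfrak k_{r+s}$, where $\mathfrak k_1,\dots,\mathfrak k_r$ are the simple ideals of $[\mathfrak k,\mathfrak k]$, $\mathfrak k_{r+1}$ is the centre of $\mathfrak k$, and $s=1$ if the centre is nontrivial, $s=0$ otherwise. Let $n=\dim\mathfrak p$, $d_i=\dim\mathfrak k_i$, and define $\kappa_i$ by $B_i=\kappa_iB|_{\mathfrak k_i}$, $B_i$ the Killing form of $\mathfrak k_i$ (so $\kappa_{r+1}=0$ and $0<\kappa_i<1$ for $i\le r$).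 Left-invariant tensor fields on $G$ are identified with bilinear forms on $\mathfrak g$; $Q|_{\mathfrak u}$ denotes $Q$ restricted to $\mathfrak u$ and extended by zero on its $Q$-orthogonal complement. $\mathcal M_K$ is the set of left-invariant metrics on $G$ naturally reductive with respect to $G\times K$ (acting by $(x,k)y=xyk^{-1}$), which by a theorem of Gordon are exactly the metrics $\beta Q|_{\mathfrak p}+\sum_i\alpha_iQ|_{\mathfrak k_i}$ with $\beta,\alpha_i>0$. *)

theory Defs
  imports "HOL-Analysis.Analysis"
begin

text \<open>Lie algebra g modelled as a finite-dimensional real vector space 'v (euclidean_space,
  whose inner product is auxiliary and only used to compute traces) with a bracket br.
  Left-invariant (0,2)-tensors are bilinear forms 'v => 'v => real.\<close>

definition lie_algebra :: "('v::euclidean_space \<Rightarrow> 'v \<Rightarrow> 'v) \<Rightarrow> bool" where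
  "lie_algebra br \<longleftrightarrow> bilinear br \<and> (\<forall>X Y. br X Y = - br Y X) \<and>
     (\<forall>X Y Z. br X (br Y Z) + br Y (br Z X) + br Z (br X Y) = 0)"

definition subalg :: "('v::euclidean_space \<Rightarrow> 'v \<Rightarrow> 'v) \<Rightarrow> 'v set \<Rightarrow> bool" where
  "subalg br a \<longleftrightarrow> subspace a \<and> (\<forall>x\<in>a. \<forall>y\<in>a. br x y \<in> a)"

definition ideal_of :: "('v::euclidean_space \<Rightarrow> 'v \<Rightarrow> 'v) \<Rightarrow> 'v set \<Rightarrow> 'v set \<Rightarrow> bool" where
  "ideal_of br a I \<longleftrightarrow> subspace I \<and> I \<subseteq> a \<and> (\<forall>x\<in>a. \<forall>y\<in>I. br x y \<in> I)"

definition simple_alg :: "('v::euclidean_space \<Rightarrow> 'v \<Rightarrow> 'v) \<Rightarrow> 'v set \<Rightarrow> bool" where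
  "simple_alg br a \<longleftrightarrow> subalg br a \<and> (\<exists>x\<in>a. \<exists>y\<in>a. br x y \<noteq> 0) \<and>
     (\<forall>J. ideal_of br a J \<longrightarrow> J = {0} \<or> J = a)"

definition derived :: "('v::euclidean_space \<Rightarrow> 'v \<Rightarrow> 'v) \<Rightarrow> 'v set \<Rightarrow> 'v set" where
  "derived br a = span {br x y | x y. x \<in> a \<and> y \<in> a}"

definition centre :: "('v::euclidean_space \<Rightarrow> 'v \<Rightarrow> 'v) \<Rightarrow> 'v set \<Rightarrow> 'v set" where
  "centre br a = {z\<in>a. \<forall>x\<in>a. br z x = 0}"

definition trace :: "('v::euclidean_space \<Rightarrow> 'v) \<Rightarrow> real" where
  "trace f = (\<Sum>b\<in>Basis. inner (f b) b)"

definition onb :: "'v::euclidean_space set \<Rightarrow> 'v set" where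
  "onb S = (SOME B. B \<subseteq> S \<and> pairwise orthogonal B \<and> (\<forall>x\<in>B. norm x = 1) \<and>
                     independent B \<and> span B = S)"

definition trace_on :: "'v::euclidean_space set \<Rightarrow> ('v \<Rightarrow> 'v) \<Rightarrow> real" where
  "trace_on S f = (\<Sum>b\<in>onb S. inner (f b) b)"

definition killing :: "('v::euclidean_space \<Rightarrow> 'v \<Rightarrow> 'v) \<Rightarrow> 'v \<Rightarrow> 'v \<Rightarrow> real" where
  "killing br X Y = trace (\<lambda>Z. br X (br Y Z))"

definition killing_on :: "('v::euclidean_space \<Rightarrow> 'v \<Rightarrow> 'v) \<Rightarrow> 'v set \<Rightarrow> 'v \<Rightarrow> 'v \<Rightarrow> real" where
  "killing_on br S X Y = trace_on S (\<lambda>Z. br X (br Y Z))"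

definition kappa :: "('v::euclidean_space \<Rightarrow> 'v \<Rightarrow> 'v) \<Rightarrow> 'v set \<Rightarrow> real" where
  "kappa br S = (SOME c. \<forall>X\<in>S. \<forall>Y\<in>S. killing_on br S X Y = c * killing br X Y)"

definition prj :: "'v::euclidean_space set \<Rightarrow> 'v set \<Rightarrow> 'v \<Rightarrow> 'v" where
  "prj k p X = (THE v. v \<in> k \<and> X - v \<in> p)"

definition Qform :: "('v::euclidean_space \<Rightarrow> 'v \<Rightarrow> 'v) \<Rightarrow> 'v set \<Rightarrow> 'v set \<Rightarrow> 'v \<Rightarrow> 'v \<Rightarrow> real" where
  "Qform br k p X Y = killing br (prj p k X) (prj p k Y) - killing br (prj k p X) (prj k p Y)"

text \<open>orthogonal projection w.r.t. a bilinear form q onto u, and q restricted to u,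
  extended by zero on the q-orthogonal complement\<close>
definition qproj :: "('v::euclidean_space \<Rightarrow> 'v \<Rightarrow> real) \<Rightarrow> 'v set \<Rightarrow> 'v \<Rightarrow> 'v" where
  "qproj q u X = (THE v. v \<in> u \<and> (\<forall>w\<in>u. q (X - v) w = 0))"

definition restr :: "('v::euclidean_space \<Rightarrow> 'v \<Rightarrow> real) \<Rightarrow> 'v set \<Rightarrow> 'v \<Rightarrow> 'v \<Rightarrow> real" where
  "restr q u X Y = q (qproj q u X) (qproj q u Y)"

text \<open>Levi-Civita connection of a left-invariant metric g on left-invariant fields (Koszul formula),
  its curvature R(X,Y)Z = nabla_X nabla_Y Z - nabla_Y nabla_X Z - nabla_[X,Y] Z,
  and Ricci tensor Ric(Y,Z) = tr (X |-> R(X,Y)Z)\<close>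
definition levi :: "('v::euclidean_space \<Rightarrow> 'v \<Rightarrow> 'v) \<Rightarrow> ('v \<Rightarrow> 'v \<Rightarrow> real) \<Rightarrow> 'v \<Rightarrow> 'v \<Rightarrow> 'v" where
  "levi br g X Y = (THE v. \<forall>W. g v W = (g (br X Y) W - g (br Y W) X + g (br W X) Y) / 2)"

definition curv :: "('v::euclidean_space \<Rightarrow> 'v \<Rightarrow> 'v) \<Rightarrow> ('v \<Rightarrow> 'v \<Rightarrow> real) \<Rightarrow> 'v \<Rightarrow> 'v \<Rightarrow> 'v \<Rightarrow> 'v" where
  "curv br g X Y Z = levi br g X (levi br g Y Z) - levi br g Y (levi br g X Z) - levi br g (br X Y) Z"

definition ricci :: "('v::euclidean_space \<Rightarrow> 'v \<Rightarrow> 'v) \<Rightarrow> ('v \<Rightarrow> 'v \<Rightarrow> real) \<Rightarrow> 'v \<Rightarrow> 'v \<Rightarrow> real" where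
  "ricci br g Y Z = trace (\<lambda>X. curv br g X Y Z)"

text \<open>the metrics beta Q|p + sum alpha_i Q|k_i, i.e. (by Gordon's theorem) the set M_K\<close>
definition MK :: "('v::euclidean_space \<Rightarrow> 'v \<Rightarrow> 'v) \<Rightarrow> 'v set \<Rightarrow> 'v set \<Rightarrow> (nat \<Rightarrow> 'v set) \<Rightarrow> nat
    \<Rightarrow> ('v \<Rightarrow> 'v \<Rightarrow> real) set" where
  "MK br k p ks m = {(\<lambda>X Y. \<beta> * restr (Qform br k p) p X Y
        + (\<Sum>i\<in>{1..m}. \<alpha> i * restr (Qform br k p) (ks i) X Y)) | \<beta> \<alpha>.
        \<beta> > 0 \<and> (\<forall>i\<in>{1..m}. \<alpha> i > 0)}"

end

theory Submission
  imports Defs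
begin

text \<open>Up to the scale \<open>\<beta>\<close>, a metric in \<open>M\<^sub>K\<close> is \<open>B\<close> on \<open>p\<close> and \<open>-B(L \<cdot>, \<cdot>)\<close> on \<open>k\<close>, where \<open>L\<close> acts on \<open>k\<^sub>i\<close>
  as the scalar \<open>l\<^sub>i = \<alpha>\<^sub>i / \<beta>\<close>. As \<open>g\<close> is unimodular and the connection torsion free,
  \<open>Ric(Y,Z) = - tr (D\<^sub>Z D\<^sub>Y)\<close> with \<open>D\<^sub>Z X = \<nabla>\<^sub>X Z\<close>. On \<open>k\<^sub>i\<close> this gives
  \<open>(\<kappa>\<^sub>i + l\<^sub>i\<^sup>2 (1 - \<kappa>\<^sub>i)) / 4\<close> times \<open>Q\<close>. On \<open>p\<close>, which is irreducible under \<open>k\<close>, Schur's lemma and a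
  trace count give \<open>- (1/2 + \<Sum> l\<^sub>i d\<^sub>i (1 - \<kappa>\<^sub>i) / (2n))\<close> times \<open>Q\<close>, and the same count for \<open>B\<close> itself is
  \<open>\<Sum> 2 d\<^sub>i (1 - \<kappa>\<^sub>i) = n\<close>. Since \<open>\<kappa>\<^sub>i < 1\<close>, the equations on the \<open>k\<^sub>i\<close> determine the \<open>l\<^sub>i\<close>, and the equation on
  \<open>p\<close> is then the formula for \<open>T\<^sub>p\<close>.\<close>

section \<open>Traces and symmetric forms\<close>

text \<open>\<open>trace_on\<close> is computed in a basis orthonormal for an inner product
  unrelated to the bracket, so invariance of B is not visible in it. Everything rests on the cyclic
  law tr(ba) = tr(ab) for maps between two subspaces: it makes traces independent of the form that
  computes them, and it turns traces over k into traces over p, so that the Ricci tensor on p is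
  written with trace forms of one type, \<open>tau\<close>. In the equation on p the constant 1/2
  stands for B seen as \<open>tau kproj\<close>; as \<open>kproj\<close> is the sum of the
  projections to the k_i, it becomes the square-root-free part of the formula for \<open>Tp\<close>.
  The square roots are l_i (1 - \<kappa>_i) with l_i = sqrt((4 T_i - \<kappa>_i) / (1 -
  \<kappa>_i)). That \<kappa>_i < 1 is strict comes from k acting faithfully on p, for simple ideals
  and centre alike. The hypotheses merely list the simple ideals of [k,k]; that they span k
  orthogonally together with the centre, and that each B_i is a multiple of B, is derived from the
  definiteness of B on k.\<close>

text \<open>A Parseval frame of the subspace \<open>S\<close> for the form \<open>q\<close>; it computes traces of
  endomorphisms of \<open>S\<close> independently of the auxiliary inner product.\<close>

definition frame :: "('v::euclidean_space \<Rightarrow> 'v \<Rightarrow> real) \<Rightarrow> 'v set \<Rightarrow> 'v set \<Rightarrow> bool" where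
  "frame q S E \<longleftrightarrow> finite E \<and> E \<subseteq> S \<and> (\<forall>x\<in>S. x = (\<Sum>e\<in>E. q x e *\<^sub>R e))"

text \<open>Expanding \<open>a e\<close> in \<open>E'\<close> and \<open>b e'\<close> in
  \<open>E\<close> turns both sides into the double sum of \<open>q' (a e) e' * q (b e') e\<close>.
  With \<open>b\<close> the identity it gives independence of the frame; with two different
  subspaces it moves a trace from one to the other.\<close>

lemma frame_trace_commute:
  assumes "frame q S E" "frame q' S' E'"
    and q: "bounded_bilinear q" "bounded_bilinear q'"
    and ab: "linear a" "linear b"
    and a: "\<And>x. x \<in> S \<Longrightarrow> a x \<in> S'" and b: "\<And>x. x \<in> S' \<Longrightarrow> b x \<in> S"
  shows "(\<Sum>e\<in>E. q (b (a e)) e) = (\<Sum>e\<in>E'. q' (a (b e)) e)"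
proof -
  have E: "finite E" "E \<subseteq> S" "\<And>x. x \<in> S \<Longrightarrow> x = (\<Sum>e\<in>E. q x e *\<^sub>R e)"
    and E': "finite E'" "E' \<subseteq> S'" "\<And>x. x \<in> S' \<Longrightarrow> x = (\<Sum>e\<in>E'. q' x e *\<^sub>R e)"
    using assms(1,2) unfolding frame_def by blast+
  have 1: "q (b (a e)) e = (\<Sum>e'\<in>E'. q' (a e) e' * q (b e') e)" if "e \<in> E" for e
  proof -
    have "b (a e) = b (\<Sum>e'\<in>E'. q' (a e) e' *\<^sub>R e')" using E'(3)[of "a e"] a that E(2) by auto
    also have "\<dots> = (\<Sum>e'\<in>E'. q' (a e) e' *\<^sub>R b e')"
      by (simp add: linear_sum[OF ab(2)] linear_cmul[OF ab(2)])
    finally show ?thesis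
      by (simp add: bounded_bilinear.sum_left[OF q(1)] bounded_bilinear.scaleR_left[OF q(1)])
  qed
  have 2: "q' (a (b e')) e' = (\<Sum>e\<in>E. q (b e') e * q' (a e) e')" if "e' \<in> E'" for e'
  proof -
    have "a (b e') = a (\<Sum>e\<in>E. q (b e') e *\<^sub>R e)" using E(3)[of "b e'"] b that E'(2) by auto
    also have "\<dots> = (\<Sum>e\<in>E. q (b e') e *\<^sub>R a e)"
      by (simp add: linear_sum[OF ab(1)] linear_cmul[OF ab(1)])
    finally show ?thesis
      by (simp add: bounded_bilinear.sum_left[OF q(2)] bounded_bilinear.scaleR_left[OF q(2)])
  qed
  show ?thesis using 1 2 by (simp add: mult.commute) (rule sum.swap)
qed

lemma onb:
  fixes S :: "'v::euclidean_space set"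
  assumes "subspace S"
  shows "onb S \<subseteq> S" "pairwise orthogonal (onb S)" "\<And>x. x \<in> onb S \<Longrightarrow> norm x = 1"
    "independent (onb S)" "span (onb S) = S"
proof -
  obtain B where "B \<subseteq> S" "pairwise orthogonal B" "\<And>x. x \<in> B \<Longrightarrow> norm x = 1"
    "independent B" "card B = dim S" "span B = S"
    using orthonormal_basis_subspace[OF assms] by blast
  then have "\<exists>B. B \<subseteq> S \<and> pairwise orthogonal B \<and> (\<forall>x\<in>B. norm x = 1) \<and> independent B \<and> span B = S"
    by blast
  from someI_ex[OF this] show "onb S \<subseteq> S" "pairwise orthogonal (onb S)"
    "\<And>x. x \<in> onb S \<Longrightarrow> norm x = 1" "independent (onb S)" "span (onb S) = S"
    unfolding onb_def by auto
qed

lemma frame_onb: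
  assumes "subspace S" shows "frame inner S (onb S)"
proof -
  have fin: "finite (onb S)" using onb(4)[OF assms] by (rule independent_imp_finite)
  have "x = (\<Sum>e\<in>onb S. (x \<bullet> e) *\<^sub>R e)" if "x \<in> S" for x
  proof -
    have "x \<in> span (onb S)" using onb(5)[OF assms] that by simp
    then obtain u where u: "x = (\<Sum>e\<in>onb S. u e *\<^sub>R e)"
      using span_finite[OF fin] by auto
    have "x \<bullet> e = u e" if e: "e \<in> onb S" for e
    proof -
      have "x \<bullet> e = (\<Sum>d\<in>onb S. u d * (d \<bullet> e))" by (simp add: u inner_sum_left)
      also have "\<dots> = (\<Sum>d\<in>onb S. if d = e then u e else 0)"
        using onb(2,3)[OF assms] e
        by (intro sum.cong) (auto simp: pairwise_def orthogonal_def dot_square_norm)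
      finally show ?thesis using fin e by simp
    qed
    then show ?thesis using u by simp
  qed
  then show ?thesis using fin onb(1)[OF assms] by (auto simp: frame_def)
qed

lemma frame_Basis: "frame inner UNIV Basis"
  by (simp add: frame_def euclidean_representation)

lemma trace_on_commute:
  assumes "subspace S" "subspace S'" "linear a" "linear b"
    and "\<And>x. x \<in> S \<Longrightarrow> a x \<in> S'" "\<And>x. x \<in> S' \<Longrightarrow> b x \<in> S"
  shows "trace_on S (\<lambda>x. b (a x)) = trace_on S' (\<lambda>x. a (b x))"
  unfolding trace_on_def
  using frame_trace_commute[OF frame_onb frame_onb bounded_bilinear_inner bounded_bilinear_inner] assms
  by blast

text \<open>With \<open>b\<close> the identity: a map with image in \<open>S\<close> has the same
  trace on the whole space as on \<open>S\<close>. This is what splits full traces into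
  blocks.\<close>

lemma trace_commute_on:
  assumes "subspace S" "linear a" "linear b" "\<And>x. a x \<in> S"
  shows "trace (\<lambda>x. b (a x)) = trace_on S (\<lambda>x. a (b x))"
  unfolding trace_on_def trace_def
  using frame_trace_commute[OF frame_Basis frame_onb bounded_bilinear_inner bounded_bilinear_inner] assms
  by blast

lemma trace_commute:
  assumes "linear a" "linear b"
  shows "trace (\<lambda>x. b (a x)) = trace (\<lambda>x. a (b x))"
  unfolding trace_def
  using frame_trace_commute[OF frame_Basis frame_Basis bounded_bilinear_inner bounded_bilinear_inner] assms
  by blast

lemma trace_on_frame:
  assumes "frame q S E" "bounded_bilinear q" "subspace S" "linear f" "\<And>x. x \<in> S \<Longrightarrow> f x \<in> S"
  shows "trace_on S f = (\<Sum>e\<in>E. q (f e) e)"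
  unfolding trace_on_def
  using frame_trace_commute[OF frame_onb assms(1) bounded_bilinear_inner assms(2,4) linear_id] assms
  by simp

lemma trace_add: "trace (\<lambda>x. f x + g x) = trace f + trace g"
  and trace_diff: "trace (\<lambda>x. f x - g x) = trace f - trace g"
  by (simp_all add: trace_def inner_add_left inner_diff_left sum.distrib sum_subtractf)

lemma trace_on_add: "trace_on S (\<lambda>x. f x + g x) = trace_on S f + trace_on S g"
  and trace_on_diff: "trace_on S (\<lambda>x. f x - g x) = trace_on S f - trace_on S g"
  and trace_on_minus: "trace_on S (\<lambda>x. - f x) = - trace_on S f"
  and trace_on_zero: "trace_on S (\<lambda>x. 0) = 0"
  and trace_on_scale: "trace_on S (\<lambda>x. c *\<^sub>R f x) = c * trace_on S f"
  and trace_on_sum: "trace_on S (\<lambda>x. \<Sum>i\<in>I. h i x) = (\<Sum>i\<in>I. trace_on S (h i))"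
      apply (simp_all add: trace_on_def inner_add_left inner_diff_left sum.distrib sum_subtractf
      sum_distrib_left sum_negf inner_sum_left)
  by (rule sum.swap)

lemma trace_on_cong:
  assumes "subspace S" "\<And>x. x \<in> S \<Longrightarrow> f x = g x"
  shows "trace_on S f = trace_on S g"
  unfolding trace_on_def using assms(2) onb(1)[OF assms(1)] by (intro sum.cong) auto

lemma trace_on_ident:
  assumes "subspace S" shows "trace_on S (\<lambda>x. x) = real (dim S)"
proof -
  have "card (onb S) = dim S" using onb[OF assms] by (metis dim_eq_card_independent dim_span)
  then show ?thesis unfolding trace_on_def using onb(3)[OF assms] by (simp add: dot_square_norm)
qed

section \<open>Forms positive definite on a subspace: frames, projections, adjoints\<close>

locale sym_form = bounded_bilinear q
  for q :: "'v::euclidean_space \<Rightarrow> 'v \<Rightarrow> real" +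
  assumes sym: "q x y = q y x"
begin

text \<open>Gram-Schmidt as an induction on dimension: normalise one vector and recurse on its
  orthogonal complement in \<open>S\<close>. Positivity is asked for on \<open>S\<close> alone, so
  that an indefinite form such as -B can be used on k.\<close>

lemma frame_exists:
  assumes "subspace S" "\<And>x. x \<in> S \<Longrightarrow> x \<noteq> 0 \<Longrightarrow> q x x > 0"
  shows "\<exists>E. frame q S E"
  using assms
proof (induction "dim S" arbitrary: S rule: less_induct)
  case less
  show ?case
  proof (cases "S = {0}")
    case True
    then show ?thesis by (intro exI[of _ "{}"]) (simp add: frame_def)
  next
    case False
    then obtain x where x: "x \<in> S" "x \<noteq> 0" using subspace_0[OF less.prems(1)] by blast
    define u where "u = (1 / sqrt (q x x)) *\<^sub>R x"
    have pos: "q x x > 0" using less.prems(2) x by blast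
    have u: "u \<in> S" using x less.prems(1) by (simp add: u_def subspace_mul)
    have quu: "q u u = 1" using pos by (simp add: u_def scaleR_left scaleR_right)
    define S' where "S' = {y\<in>S. q y u = 0}"
    have S': "subspace S'"
      using less.prems(1) unfolding S'_def subspace_def by (auto simp: add_left scaleR_left zero_left)
    have "u \<notin> S'" using quu by (simp add: S'_def)
    then have "S' \<subset> S" using u unfolding S'_def by blast
    then have "dim S' < dim S"
      using S' less.prems(1) by (metis dim_psubset span_eq_iff)
    then obtain E where E: "frame q S' E"
      using less.hyps S' less.prems(2) unfolding S'_def by blast
    have uE: "u \<notin> E" using E quu by (auto simp: frame_def S'_def)
    have "y = (\<Sum>e\<in>insert u E. q y e *\<^sub>R e)" if y: "y \<in> S" for y
    proof -
      have "y - q y u *\<^sub>R u \<in> S'"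
        using y u less.prems(1) quu by (auto simp: S'_def diff_left scaleR_left subspace_diff subspace_mul)
      then have "y - q y u *\<^sub>R u = (\<Sum>e\<in>E. q (y - q y u *\<^sub>R u) e *\<^sub>R e)"
        using E by (auto simp: frame_def)
      also have "\<dots> = (\<Sum>e\<in>E. q y e *\<^sub>R e)"
        using E by (intro sum.cong) (auto simp: frame_def S'_def diff_left scaleR_left sym[of u])
      finally show ?thesis using E uE by (simp add: frame_def algebra_simps)
    qed
    then have "frame q S (insert u E)" using E u by (auto simp: frame_def S'_def)
    then show ?thesis by blast
  qed
qed

context
  fixes S
  assumes S: "subspace S" and pos: "\<And>x. x \<in> S \<Longrightarrow> x \<noteq> 0 \<Longrightarrow> q x x > 0"
begin

lemma qproj_eqI:
  assumes "v \<in> S" "\<And>w. w \<in> S \<Longrightarrow> q (x - v) w = 0"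
  shows "qproj q S x = v"
  unfolding qproj_def
proof (rule the_equality)
  show "v \<in> S \<and> (\<forall>w\<in>S. q (x - v) w = 0)" using assms by blast
  fix v' assume v': "v' \<in> S \<and> (\<forall>w\<in>S. q (x - v') w = 0)"
  have "v - v' \<in> S" using assms v' S by (simp add: subspace_diff)
  moreover have "q (v - v') (v - v') = q (x - v') (v - v') - q (x - v) (v - v')"
    by (simp add: diff_left)
  ultimately have "q (v - v') (v - v') = 0" using assms v' by simp
  then show "v' = v" using pos \<open>v - v' \<in> S\<close> by fastforce
qed

lemma qproj_frame:
  assumes "frame q S E"
  shows "qproj q S x = (\<Sum>e\<in>E. q x e *\<^sub>R e)"
proof (rule qproj_eqI)
  show "(\<Sum>e\<in>E. q x e *\<^sub>R e) \<in> S"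
    using assms S by (auto simp: frame_def intro!: subspace_sum subspace_mul)
  fix w assume "w \<in> S"
  then have "q x w = q x (\<Sum>e\<in>E. q w e *\<^sub>R e)" using assms by (auto simp: frame_def)
  then show "q (x - (\<Sum>e\<in>E. q x e *\<^sub>R e)) w = 0"
    by (simp add: diff_left sum_left sum_right scaleR_left scaleR_right sym[of w] mult.commute)
qed

lemma qproj_linear: "linear (qproj q S)"
proof -
  obtain E where "frame q S E" using frame_exists[OF S pos] by blast
  then have "qproj q S = (\<lambda>x. \<Sum>e\<in>E. q x e *\<^sub>R e)" using qproj_frame by auto
  then show ?thesis
    by (auto intro!: linearI simp: add_left scaleR_left sum.distrib scaleR_add_left scaleR_sum_right)
qed

lemma qproj_in: "qproj q S x \<in> S" and qproj_orth: "w \<in> S \<Longrightarrow> q (x - qproj q S x) w = 0"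
proof -
  obtain E where E: "frame q S E" using frame_exists[OF S pos] by blast
  show "qproj q S x \<in> S"
    using E S unfolding qproj_frame[OF E] by (auto simp: frame_def intro!: subspace_sum subspace_mul)
  assume w: "w \<in> S"
  then have "q x w = q x (\<Sum>e\<in>E. q w e *\<^sub>R e)" using E by (auto simp: frame_def)
  then show "q (x - qproj q S x) w = 0"
    unfolding qproj_frame[OF E]
    by (simp add: diff_left sum_left sum_right scaleR_left scaleR_right sym[of w] mult.commute)
qed

lemma qproj_ident: "x \<in> S \<Longrightarrow> qproj q S x = x"
  by (rule qproj_eqI) (auto simp: zero_left)

lemma trace_on_adjoint:
  assumes "linear f" "linear g" "\<And>x. x \<in> S \<Longrightarrow> f x \<in> S" "\<And>x. x \<in> S \<Longrightarrow> g x \<in> S"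
    and "\<And>x. x \<in> S \<Longrightarrow> q (f x) x = q x (g x)"
  shows "trace_on S f = trace_on S g"
proof -
  obtain E where E: "frame q S E" using frame_exists[OF S pos] by blast
  have "trace_on S f = (\<Sum>e\<in>E. q (f e) e)" "trace_on S g = (\<Sum>e\<in>E. q (g e) e)"
    using trace_on_frame[OF E bounded_bilinear_axioms S] assms by blast+
  moreover have "q (f e) e = q (g e) e" if "e \<in> E" for e
    using assms(5)[of e] that E by (auto simp: frame_def sym)
  ultimately show ?thesis by simp
qed

lemma trace_on_skew:
  assumes "linear f" "\<And>x. x \<in> S \<Longrightarrow> f x \<in> S" "\<And>x. x \<in> S \<Longrightarrow> q (f x) x = 0"
  shows "trace_on S f = 0"
proof -
  have "linear (\<lambda>x. - f x)" using assms(1) by (rule linear_compose_neg)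
  then have "trace_on S f = trace_on S (\<lambda>x. - f x)"
    using assms S by (intro trace_on_adjoint) (auto simp: minus_right sym subspace_neg)
  then show ?thesis by (simp add: trace_on_minus)
qed

end

end

text \<open>Schur's lemma for symmetric forms: the radical of \<open>\<sigma> - c q\<close>, where \<open>c\<close> is the minimum
  of the Rayleigh quotient, is a nonzero invariant subspace.\<close>

lemma schur_symmetric_form:
  fixes q \<sigma> :: "'v::euclidean_space \<Rightarrow> 'v \<Rightarrow> real" and \<phi> :: "'u \<Rightarrow> 'v \<Rightarrow> 'v"
  assumes "sym_form q" "sym_form \<sigma>"
    and S: "subspace S" "S \<noteq> {0}" and pos: "\<And>x. x \<in> S \<Longrightarrow> x \<noteq> 0 \<Longrightarrow> q x x > 0"
    and inv: "\<And>u x. u \<in> K \<Longrightarrow> x \<in> S \<Longrightarrow> \<phi> u x \<in> S"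
    and qskew: "\<And>u x y. u \<in> K \<Longrightarrow> x \<in> S \<Longrightarrow> y \<in> S \<Longrightarrow> q (\<phi> u x) y = - q x (\<phi> u y)"
    and sskew: "\<And>u x y. u \<in> K \<Longrightarrow> x \<in> S \<Longrightarrow> y \<in> S \<Longrightarrow> \<sigma> (\<phi> u x) y = - \<sigma> x (\<phi> u y)"
    and irr: "\<And>J. subspace J \<Longrightarrow> J \<subseteq> S \<Longrightarrow> (\<And>u x. u \<in> K \<Longrightarrow> x \<in> J \<Longrightarrow> \<phi> u x \<in> J) \<Longrightarrow> J = {0} \<or> J = S"
  shows "\<exists>c. \<forall>x\<in>S. \<forall>y\<in>S. \<sigma> x y = c * q x y"
proof -
  interpret q: sym_form q by fact
  interpret s: sym_form \<sigma> by fact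
  \<comment> \<open>The Rayleigh quotient does not change under scaling, so the auxiliary norm
    serves only to supply a compact set on which the minimum is attained.\<close>
  define U where "U = S \<inter> sphere 0 1"
  obtain z where z: "z \<in> S" "z \<noteq> 0" using S subspace_0[OF S(1)] by blast
  have "(1 / norm z) *\<^sub>R z \<in> U" using z S(1) by (simp add: U_def subspace_mul)
  then have "U \<noteq> {}" by blast
  moreover have "compact U"
    unfolding U_def using closed_subspace[OF S(1)] by (intro closed_Int_compact) auto
  moreover have "continuous_on U (\<lambda>x. \<sigma> x x / q x x)"
  proof (intro continuous_on_divide s.continuous_on q.continuous_on continuous_on_id ballI)
    fix x assume "x \<in> U"
    then have "x \<in> S" "x \<noteq> 0" by (auto simp: U_def)
    then show "q x x \<noteq> 0" using pos[of x] by simp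
  qed
  ultimately obtain x0 where x0: "x0 \<in> U" and min: "\<And>x. x \<in> U \<Longrightarrow> \<sigma> x0 x0 / q x0 x0 \<le> \<sigma> x x / q x x"
    using continuous_attains_inf[of U "\<lambda>x. \<sigma> x x / q x x"] by blast
  define c where "c = \<sigma> x0 x0 / q x0 x0"
  have x0S: "x0 \<in> S" "x0 \<noteq> 0" using x0 by (auto simp: U_def)
  define h where "h x y = \<sigma> x y - c * q x y" for x y
  have h_nonneg: "h x x \<ge> 0" if x: "x \<in> S" for x
  proof (cases "x = 0")
    case True then show ?thesis by (simp add: h_def s.zero_left q.zero_left)
  next
    case False
    have "(1 / norm x) *\<^sub>R x \<in> U" using False x S(1) by (simp add: U_def subspace_mul)
    from min[OF this] have "c \<le> \<sigma> x x / q x x"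
      using False by (simp add: c_def s.scaleR_left s.scaleR_right q.scaleR_left q.scaleR_right)
    then show ?thesis using pos[OF x False] by (simp add: h_def field_simps)
  qed
  have hx0: "h x0 x0 = 0" using pos[OF x0S] by (simp add: h_def c_def)
  have h0: "h x0 y = 0" if y: "y \<in> S" for y
  proof (rule ccontr)
    assume n: "h x0 y \<noteq> 0"
    have quad: "2 * t * h x0 y + t\<^sup>2 * h y y \<ge> 0" for t
    proof -
      have "x0 + t *\<^sub>R y \<in> S" using x0S y S(1) by (simp add: subspace_add subspace_mul)
      from h_nonneg[OF this] hx0 show ?thesis
        by (simp add: h_def s.add_left s.add_right s.scaleR_left s.scaleR_right q.add_left q.add_right
            q.scaleR_left q.scaleR_right s.sym[of y x0] q.sym[of y x0] algebra_simps power2_eq_square)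
    qed
    \<comment> \<open>Adding 1 keeps the denominator positive even if \<open>h y y = 0\<close>. At t
      = - \<open>h x0 y\<close> / m the quadratic in \<open>quad\<close> equals
      (\<open>h x0 y\<close>)^2 (\<open>h y y\<close> - 2m) / m^2, which is negative.\<close>
    define m where "m = h y y + 1"
    have m: "m \<ge> 1" using h_nonneg[OF y] by (simp add: m_def)
    have "2 * (- h x0 y / m) * h x0 y + (- h x0 y / m)\<^sup>2 * h y y \<ge> 0" by (rule quad)
    then have "m\<^sup>2 * (2 * (- h x0 y / m) * h x0 y + (- h x0 y / m)\<^sup>2 * h y y) \<ge> 0" by simp
    moreover have "m\<^sup>2 * (2 * (- h x0 y / m) * h x0 y + (- h x0 y / m)\<^sup>2 * h y y)
        = (h x0 y)\<^sup>2 * (h y y - 2 * m)"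
      using m by (simp add: field_simps power2_eq_square)
    moreover have "(h x0 y)\<^sup>2 * (h y y - 2 * m) < 0"
      using n m h_nonneg[OF y] by (intro mult_pos_neg) (auto simp: m_def)
    ultimately show False by linarith
  qed
  define J where "J = {x\<in>S. \<forall>y\<in>S. h x y = 0}"
  have "subspace J"
    using S(1) unfolding J_def subspace_def h_def
    by (auto simp: s.zero_left q.zero_left s.add_left q.add_left s.scaleR_left q.scaleR_left algebra_simps)
  moreover have "\<phi> u x \<in> J" if "u \<in> K" "x \<in> J" for u x
    using that inv qskew sskew unfolding J_def h_def by (auto simp: algebra_simps)
  ultimately have "J = {0} \<or> J = S" using irr unfolding J_def by blast
  moreover have "x0 \<in> J" using h0 x0S by (simp add: J_def)
  ultimately have "J = S" using x0S by blast
  then show ?thesis unfolding J_def h_def by (intro exI[of _ c]) auto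
qed

section \<open>The Killing form\<close>

locale lie_alg =
  fixes br :: "'v::euclidean_space \<Rightarrow> 'v \<Rightarrow> 'v"
  assumes lie: "lie_algebra br"
begin

sublocale br: bounded_bilinear br
  using lie by (simp add: lie_algebra_def bilinear_conv_bounded_bilinear)

lemma br_anti: "br X Y = - br Y X"
  and jacobi: "br X (br Y Z) + br Y (br Z X) + br Z (br X Y) = 0"
  using lie unfolding lie_algebra_def by blast+

lemma br_br: "br (br X Y) Z = br X (br Y Z) - br Y (br X Z)"
proof -
  have "br (br X Y) Z = - br Z (br X Y)" by (rule br_anti)
  also have "\<dots> = br X (br Y Z) + br Y (br Z X)" using jacobi[of X Y Z] by (metis add.commute minus_unique)
  also have "br Z X = - br X Z" by (rule br_anti)
  finally show ?thesis by (simp add: br.minus_right)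
qed

lemma linear_ad: "linear (br X)"
  by (rule bounded_linear.linear[OF br.bounded_linear_right])

lemmas linear_ad2 = linear_compose[OF linear_ad linear_ad, unfolded o_def]

lemma killing_on_sym:
  assumes "subspace S" "\<And>W. W \<in> S \<Longrightarrow> br X W \<in> S" "\<And>W. W \<in> S \<Longrightarrow> br Y W \<in> S"
  shows "killing_on br S X Y = killing_on br S Y X"
  unfolding killing_on_def
  using trace_on_commute[OF assms(1) assms(1) linear_ad linear_ad] assms by blast

text \<open>After expanding both brackets by \<open>br_br\<close>, only tr(YXZ) = tr(XZY) is left,
  which is cyclicity. \<open>S\<close> has to be stable under the three operators but need not
  contain \<open>X\<close>, \<open>Y\<close>, \<open>Z\<close>.\<close>

lemma killing_on_inv:
  assumes S: "subspace S" and X: "\<And>W. W \<in> S \<Longrightarrow> br X W \<in> S"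
    and Y: "\<And>W. W \<in> S \<Longrightarrow> br Y W \<in> S" and Z: "\<And>W. W \<in> S \<Longrightarrow> br Z W \<in> S"
  shows "killing_on br S (br X Y) Z = killing_on br S X (br Y Z)"
proof -
  have "trace_on S (\<lambda>W. br Y (br X (br Z W))) = trace_on S (\<lambda>W. br X (br Z (br Y W)))"
    using trace_on_commute[OF S S linear_ad2[of X Z] linear_ad[of Y]] X Y Z by blast
  then show ?thesis
    by (simp add: killing_on_def br_br br.diff_right trace_on_diff)
qed

lemma killing_on_add_left: "killing_on br S (X + Y) Z = killing_on br S X Z + killing_on br S Y Z"
  and killing_on_add_right: "killing_on br S X (Y + Z) = killing_on br S X Y + killing_on br S X Z"
  and killing_on_scale_left: "killing_on br S (c *\<^sub>R X) Z = c * killing_on br S X Z"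
  and killing_on_scale_right: "killing_on br S X (c *\<^sub>R Z) = c * killing_on br S X Z"
  by (simp_all add: killing_on_def br.add_left br.add_right br.scaleR_left br.scaleR_right
      trace_on_add trace_on_scale)

lemma bounded_bilinear_killing_on: "bounded_bilinear (killing_on br S)"
proof -
  have "bilinear (killing_on br S)"
    unfolding bilinear_def
    by (auto intro!: linearI simp: killing_on_add_left killing_on_add_right
        killing_on_scale_left killing_on_scale_right)
  then show ?thesis by (simp add: bilinear_conv_bounded_bilinear)
qed

lemma trace_eq_trace_on: "linear f \<Longrightarrow> trace f = trace_on UNIV f"
  using trace_commute_on[of UNIV f id] by (simp add: linear_id)

lemma killing_eq: "killing br = killing_on br UNIV"
  by (intro ext) (simp add: killing_def killing_on_def trace_eq_trace_on linear_ad2)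

sublocale B: sym_form "killing br"
proof -
  interpret bounded_bilinear "killing br" by (simp add: killing_eq bounded_bilinear_killing_on)
  show "sym_form (killing br)"
    by unfold_locales (simp add: killing_eq killing_on_sym)
qed

lemma killing_inv: "killing br (br X Y) Z = killing br X (br Y Z)"
  by (simp add: killing_eq killing_on_inv)

lemma killing_skew: "killing br (br U X) Y = - killing br X (br U Y)"
  using killing_inv[of X U Y] br_anti[of U X] by (simp add: B.minus_left)

end

section \<open>Cartan decompositions\<close>

text \<open>Maximal compactness of K enters in infinitesimal form: B is negative definite on k,
  positive definite on its complement p, and [p,p] lies in k. The remaining relation, that [k,p]
  lies in p, follows from invariance of B.\<close>

locale cartan = lie_alg br
  for br :: "'v::euclidean_space \<Rightarrow> 'v \<Rightarrow> 'v" +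
  fixes k p :: "'v set"
  assumes simple: "simple_alg br UNIV"
    and k_sub: "subalg br k"
    and k_negdef: "\<forall>X\<in>k. X \<noteq> 0 \<longrightarrow> killing br X X < 0"
    and p_def: "p = {X. \<forall>Y\<in>k. killing br X Y = 0}"
    and p_posdef: "\<forall>X\<in>p. X \<noteq> 0 \<longrightarrow> killing br X X > 0"
    and pp: "\<forall>X\<in>p. \<forall>Y\<in>p. br X Y \<in> k"
    and noncompact: "p \<noteq> {0}"
begin

abbreviation "KF \<equiv> killing br"
abbreviation "Q \<equiv> Qform br k p"

lemma sub_k: "subspace k" using k_sub by (simp add: subalg_def)

lemma sub_p: "subspace p"
  by (auto simp: p_def subspace_def B.zero_left B.add_left B.scaleR_left)

lemma kp_orth: "x \<in> k \<Longrightarrow> y \<in> p \<Longrightarrow> KF x y = 0" "x \<in> k \<Longrightarrow> y \<in> p \<Longrightarrow> KF y x = 0"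
  by (auto simp: p_def B.sym)

lemma br_kk: "x \<in> k \<Longrightarrow> y \<in> k \<Longrightarrow> br x y \<in> k"
  using k_sub by (simp add: subalg_def)

lemma br_kp: "x \<in> k \<Longrightarrow> y \<in> p \<Longrightarrow> br x y \<in> p"
  using br_kk by (auto simp: p_def killing_skew)

lemma br_pk: "x \<in> p \<Longrightarrow> y \<in> k \<Longrightarrow> br x y \<in> p"
  using br_kp[of y x] br_anti[of x y] sub_p by (simp add: subspace_neg)

lemma br_pp: "x \<in> p \<Longrightarrow> y \<in> p \<Longrightarrow> br x y \<in> k"
  using pp by blast

lemma kp_int: "x \<in> k \<Longrightarrow> x \<in> p \<Longrightarrow> x = 0"
  using k_negdef p_posdef by fastforce

text \<open>\<open>Qform\<close> is itself defined through the projections \<open>prj\<close>, so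
  the projection to k is built from -B, which is positive on k, and identified with
  \<open>prj\<close> afterwards.\<close>

definition kproj :: "'v \<Rightarrow> 'v" where "kproj = qproj (\<lambda>x y. - KF x y) k"
definition pproj :: "'v \<Rightarrow> 'v" where "pproj X = X - kproj X"

lemma minus_killing: "sym_form (\<lambda>x y. - KF x y)"
proof -
  have "bounded_bilinear (\<lambda>x y. - KF x y)"
    unfolding bilinear_conv_bounded_bilinear[symmetric] bilinear_def
    by (auto intro!: linearI simp: B.add_left B.add_right B.scaleR_left B.scaleR_right)
  then show ?thesis by (simp add: sym_form_def sym_form_axioms_def B.sym)
qed

lemma linear_kproj: "linear kproj"
  and kproj_in: "kproj X \<in> k"
  and kproj_orth: "Y \<in> k \<Longrightarrow> KF (X - kproj X) Y = 0"
  and kproj_k: "X \<in> k \<Longrightarrow> kproj X = X"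
proof -
  interpret m: sym_form "\<lambda>x y. - KF x y" by (rule minus_killing)
  have pos: "\<And>x. x \<in> k \<Longrightarrow> x \<noteq> 0 \<Longrightarrow> - KF x x > 0" using k_negdef by auto
  show "linear kproj" unfolding kproj_def by (rule m.qproj_linear[OF sub_k pos])
  show "kproj X \<in> k" unfolding kproj_def by (rule m.qproj_in[OF sub_k pos])
  show "Y \<in> k \<Longrightarrow> KF (X - kproj X) Y = 0" 
    using m.qproj_orth[OF sub_k pos, of Y X] unfolding kproj_def by simp
  show "X \<in> k \<Longrightarrow> kproj X = X" unfolding kproj_def by (rule m.qproj_ident[OF sub_k pos])
qed

lemma pproj_in: "pproj X \<in> p" using kproj_orth by (simp add: pproj_def p_def)

lemma linear_pproj: "linear pproj"
  unfolding pproj_def[abs_def] by (intro linear_compose_sub linear_kproj linear_ident)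

lemma split: "X = kproj X + pproj X" by (simp add: pproj_def)

lemma kproj_p: "X \<in> p \<Longrightarrow> kproj X = 0"
proof -
  assume "X \<in> p"
  then have "X - pproj X \<in> p" using pproj_in sub_p by (simp add: subspace_diff)
  then show ?thesis using kproj_in kp_int by (simp add: pproj_def)
qed

lemma pproj_p: "X \<in> p \<Longrightarrow> pproj X = X" and pproj_k: "X \<in> k \<Longrightarrow> pproj X = 0"
  by (simp_all add: pproj_def kproj_p kproj_k)

lemma prj_k: "prj k p X = kproj X"
  unfolding prj_def
proof (rule the_equality)
  show "kproj X \<in> k \<and> X - kproj X \<in> p" using kproj_in pproj_in by (simp add: pproj_def)
  fix v assume v: "v \<in> k \<and> X - v \<in> p"
  have "kproj X = kproj (v + (X - v))" by simp
  also have "\<dots> = v" using v by (simp only: linear_add[OF linear_kproj] kproj_k kproj_p) simp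
  finally show "v = kproj X" by simp
qed

lemma prj_p: "prj p k X = pproj X"
  unfolding prj_def
proof (rule the_equality)
  show "pproj X \<in> p \<and> X - pproj X \<in> k" using kproj_in pproj_in by (simp add: pproj_def)
  fix v assume v: "v \<in> p \<and> X - v \<in> k"
  have "pproj X = pproj (v + (X - v))" by simp
  also have "\<dots> = v" using v by (simp only: linear_add[OF linear_pproj] pproj_k pproj_p) simp
  finally show "v = pproj X" by simp
qed

lemma Q_eq: "Q X Y = KF (pproj X) (pproj Y) - KF (kproj X) (kproj Y)"
  by (simp add: Qform_def prj_k prj_p)

lemma Q_k: "X \<in> k \<Longrightarrow> Q X Y = - KF X Y" "X \<in> k \<Longrightarrow> Q Y X = - KF Y X"
  and Q_p: "X \<in> p \<Longrightarrow> Q X Y = KF X Y" "X \<in> p \<Longrightarrow> Q Y X = KF Y X"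
proof -
  have 1: "KF X Y = KF (kproj X) (kproj Y) + KF (pproj X) (pproj Y)" for X Y
  proof -
    have "KF X Y = KF (kproj X + pproj X) (kproj Y + pproj Y)"
      by (simp flip: split)
    then show ?thesis
      by (simp add: B.add_left B.add_right kp_orth kproj_in pproj_in)
  qed
  show "X \<in> k \<Longrightarrow> Q X Y = - KF X Y" "X \<in> k \<Longrightarrow> Q Y X = - KF Y X"
    "X \<in> p \<Longrightarrow> Q X Y = KF X Y" "X \<in> p \<Longrightarrow> Q Y X = KF Y X"
    using 1[of X Y] 1[of Y X]
    by (simp_all add: Q_eq pproj_k pproj_p kproj_k kproj_p B.zero_left B.zero_right)
qed

sublocale Q: sym_form Q
proof -
  have "bilinear Q"
    unfolding bilinear_def
    by (auto intro!: linearI simp: Q_eq linear_add[OF linear_kproj] linear_add[OF linear_pproj]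
        linear_cmul[OF linear_kproj] linear_cmul[OF linear_pproj] B.add_left B.add_right
        B.scaleR_left B.scaleR_right algebra_simps)
  then show "sym_form Q"
    by (simp add: sym_form_def sym_form_axioms_def bilinear_conv_bounded_bilinear Q_eq B.sym)
qed

lemma Q_pos: "x \<noteq> 0 \<Longrightarrow> Q x x > 0"
proof -
  assume "x \<noteq> 0"
  then have "kproj x \<noteq> 0 \<or> pproj x \<noteq> 0" using split[of x] by auto
  moreover have "KF (pproj x) (pproj x) \<ge> 0" 
    using p_posdef pproj_in[of x] by (cases "pproj x = 0") (auto simp: B.zero_left intro: less_imp_le)
  moreover have "KF (kproj x) (kproj x) \<le> 0" 
    using k_negdef kproj_in[of x] by (cases "kproj x = 0") (auto simp: B.zero_left intro: less_imp_le)
  ultimately show ?thesis using k_negdef p_posdef kproj_in[of x] pproj_in[of x] unfolding Q_eq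
    by (smt (verit))
qed

lemma Q_kp: "x \<in> k \<Longrightarrow> y \<in> p \<Longrightarrow> Q x y = 0" "x \<in> k \<Longrightarrow> y \<in> p \<Longrightarrow> Q y x = 0"
  by (simp_all add: Q_k kp_orth)

lemma kproj_br: "U \<in> k \<Longrightarrow> kproj (br U X) = br U (kproj X)"
proof -
  assume U: "U \<in> k"
  have "br U X = br U (kproj X) + br U (pproj X)"
    using split[of X] by (metis br.add_right)
  then show ?thesis using U
    by (simp add: linear_add[OF linear_kproj] kproj_k kproj_p br_kk br_kp kproj_in pproj_in)
qed

lemma pproj_br: "U \<in> k \<Longrightarrow> pproj (br U X) = br U (pproj X)"
  by (simp add: pproj_def kproj_br br.diff_right)

text \<open>For \<open>U\<close> in k the operator \<open>br U\<close> commutes with both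
  projections, so the skewness of \<open>br U\<close> for B survives the sign change of B on
  k.\<close>

lemma Q_skew: "U \<in> k \<Longrightarrow> Q (br U X) Y = - Q X (br U Y)"
  by (simp add: Q_eq pproj_br kproj_br killing_skew)

lemma qproj_p: "qproj Q p X = pproj X"
  by (rule Q.qproj_eqI[OF sub_p Q_pos]) (simp_all add: pproj_in pproj_in[unfolded pproj_def] pproj_def Q_kp kproj_in)

section \<open>Traces along the decomposition into k and p\<close>

lemma trace_split:
  assumes "linear f"
  shows "trace f = trace_on k (\<lambda>X. kproj (f X)) + trace_on p (\<lambda>X. pproj (f X))"
proof -
  have "trace f = trace (\<lambda>X. kproj (f X) + pproj (f X))" using split by metis
  also have "\<dots> = trace (\<lambda>X. kproj (f X)) + trace (\<lambda>X. pproj (f X))" by (rule trace_add)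
  also have "trace (\<lambda>X. kproj (f X)) = trace_on k (\<lambda>X. kproj (f X))"
    using trace_commute_on[OF sub_k linear_compose[OF assms linear_kproj] linear_id] kproj_in by simp
  also have "trace (\<lambda>X. pproj (f X)) = trace_on p (\<lambda>X. pproj (f X))"
    using trace_commute_on[OF sub_p linear_compose[OF assms linear_pproj] linear_id] pproj_in by simp
  finally show ?thesis .
qed

lemma trace_odd:
  assumes "linear f" "\<And>X. X \<in> k \<Longrightarrow> f X \<in> p" "\<And>X. X \<in> p \<Longrightarrow> f X \<in> k"
  shows "trace f = 0"
proof -
  have "trace_on k (\<lambda>X. kproj (f X)) = trace_on k (\<lambda>X. 0)" "trace_on p (\<lambda>X. pproj (f X)) = trace_on p (\<lambda>X. 0)"
    using assms by (auto intro!: trace_on_cong sub_k sub_p simp: kproj_p pproj_k)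
  then show ?thesis by (simp add: trace_split[OF assms(1)] trace_on_zero)
qed

text \<open>Unimodularity: the k-part of \<open>W\<close> acts by a \<open>Q\<close>-skew map, and
  the p-part exchanges k and p, so its diagonal blocks vanish.\<close>

lemma trace_ad: "trace (br W) = 0"
proof -
  have "trace (br (kproj W)) = trace_on UNIV (br (kproj W))" by (rule trace_eq_trace_on[OF linear_ad])
  also have "\<dots> = 0"
  proof (rule Q.trace_on_skew[OF subspace_UNIV Q_pos linear_ad])
    show "Q (br (kproj W) x) x = 0" for x
      using Q_skew[OF kproj_in, of W x x] Q.sym[of x] by simp
  qed auto
  finally have "trace (br (kproj W)) = 0" .
  moreover have "trace (br (pproj W)) = 0"
    by (rule trace_odd) (auto intro: linear_ad br_pk br_pp pproj_in)
  moreover have "br W = (\<lambda>X. br (kproj W) X + br (pproj W) X)"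
    using split[of W] by (metis br.add_left)
  ultimately show ?thesis by (metis trace_add add.right_neutral)
qed

text \<open>\<open>killing_on br p\<close> is the trace form of the isotropy representation of k on
  p. Elements of k preserve both summands, so B on k is the Killing form of k plus this trace
  form.\<close>

lemma killing_split:
  assumes "X \<in> k" "Y \<in> k"
  shows "KF X Y = killing_on br k X Y + killing_on br p X Y"
proof -
  have "trace_on k (\<lambda>W. kproj (br X (br Y W))) = killing_on br k X Y"
    "trace_on p (\<lambda>W. pproj (br X (br Y W))) = killing_on br p X Y"
    unfolding killing_on_def using assms
    by (auto intro!: trace_on_cong sub_k sub_p simp: kproj_k pproj_p br_kk br_kp)
  then show ?thesis by (simp add: killing_def trace_split[OF linear_ad2])
qed

text \<open>For \<open>X\<close> and \<open>Y\<close> in p the product of the two operators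
  preserves k and p. Cyclicity carries the trace over k to p with the factors exchanged, so B on p
  becomes a trace over p alone, in the shape of \<open>tau\<close>.\<close>

lemma killing_split_p:
  assumes "X \<in> p" "Y \<in> p"
  shows "KF X Y = trace_on p (\<lambda>W. br X (br Y W)) + trace_on p (\<lambda>W. br Y (br X W))"
proof -
  have "trace_on k (\<lambda>W. kproj (br X (br Y W))) = trace_on k (\<lambda>W. br X (br Y W))"
    "trace_on p (\<lambda>W. pproj (br X (br Y W))) = trace_on p (\<lambda>W. br X (br Y W))"
    using assms by (auto intro!: trace_on_cong sub_k sub_p simp: kproj_k pproj_p br_pp br_pk)
  moreover have "trace_on k (\<lambda>W. br X (br Y W)) = trace_on p (\<lambda>W. br Y (br X W))"
    using trace_on_commute[OF sub_k sub_p linear_ad[of Y] linear_ad[of X]] assms br_pp br_pk by blast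
  ultimately show ?thesis by (simp add: killing_def trace_split[OF linear_ad2])
qed

text \<open>If \<open>J\<close> is a \<open>k\<close>-invariant subspace of \<open>p\<close>, then \<open>J + [J,J]\<close> is an ideal of \<open>g\<close>.\<close>

lemma p_irreducible:
  assumes J: "subspace J" "J \<subseteq> p" and inv: "\<And>u x. u \<in> k \<Longrightarrow> x \<in> J \<Longrightarrow> br u x \<in> J"
  shows "J = {0} \<or> J = p"
proof -
  \<comment> \<open>Invariance gives B([x,y],[x,y]) = B(y,[[x,y],x]). As [x,y] lies in k it
    preserves \<open>J\<close>, so the right side vanishes, and B is definite on k.\<close>
  have comm: "br x y = 0" if x: "x \<in> J" and y: "y \<in> p" "\<And>w. w \<in> J \<Longrightarrow> KF y w = 0" for x y
  proof (rule ccontr)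
    assume n: "br x y \<noteq> 0"
    have k: "br x y \<in> k" using x y J br_pp by blast
    have "KF (br x y) (br x y) = KF x (br y (br x y))" by (rule killing_inv)
    also have "\<dots> = KF (br y (br x y)) x" by (rule B.sym)
    also have "\<dots> = KF y (br (br x y) x)" by (rule killing_inv)
    also have "\<dots> = 0" using y(2) inv[OF k x] by simp
    finally show False using k_negdef k n by auto
  qed
  define D where "D = span {br x y | x y. x \<in> J \<and> y \<in> J}"
  have Dk: "D \<subseteq> k" unfolding D_def by (rule span_minimal) (use J br_pp sub_k in auto)
  have D0: "br x y \<in> D" if "x \<in> J" "y \<in> J" for x y
    unfolding D_def using that by (intro span_base) auto
  have sD: "subspace D" by (simp add: D_def)
  have DI: "br u d \<in> E" if E: "subspace E" and d: "d \<in> D"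
    and g: "\<And>x y. x \<in> J \<Longrightarrow> y \<in> J \<Longrightarrow> br u (br x y) \<in> E" for u d E
  proof -
    have "subspace {d. br u d \<in> E}"
      using E by (auto simp: subspace_def br.zero_right br.add_right br.scaleR_right)
    then have "D \<subseteq> {d. br u d \<in> E}" unfolding D_def by (intro span_minimal) (use g in auto)
    then show ?thesis using d by blast
  qed
  have kD: "br u d \<in> D" if "u \<in> k" "d \<in> D" for u d
  proof (rule DI[OF sD that(2)])
    fix x y assume xy: "x \<in> J" "y \<in> J"
    have "br u (br x y) = br (br u x) y + br x (br u y)" by (simp add: br_br)
    then show "br u (br x y) \<in> D"
      using xy D0 inv[OF that(1)] sD by (simp add: subspace_add)
  qed
  have JD: "br x d \<in> J" if "x \<in> J" "d \<in> D" for x d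
    using inv[of d x] that Dk br_anti[of x d] J(1) by (auto simp: subspace_neg)
  \<comment> \<open>The component of \<open>y\<close> orthogonal to \<open>J\<close> commutes with
    \<open>J\<close> by \<open>comm\<close>, so only the projection of \<open>y\<close> to
    \<open>J\<close> contributes.\<close>
  have pJ: "br y x \<in> D" if "y \<in> p" "x \<in> J" for y x
  proof -
    let ?y = "qproj Q J y"
    have y: "?y \<in> J" by (rule Q.qproj_in[OF J(1) Q_pos])
    then have "y - ?y \<in> p" using that J sub_p by (auto intro: subspace_diff)
    moreover have "KF (y - ?y) w = 0" if "w \<in> J" for w
      using Q.qproj_orth[OF J(1) Q_pos that, of y] Q_p(2)[of w] that J by auto
    ultimately have "br x (y - ?y) = 0" using comm that by blast
    then have "br y x = br ?y x" using br_anti[of x "y - ?y"] by (simp add: br.diff_left)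
    then show ?thesis using D0[OF y that(2)] by simp
  qed
  have pD: "br y d \<in> J" if "y \<in> p" "d \<in> D" for y d
  proof (rule DI[OF J(1) that(2)])
    fix x x' assume x: "x \<in> J" "x' \<in> J"
    have "br y (br x x') = br (br y x) x' + br x (br y x')" by (simp add: br_br)
    moreover have "br (br y x) x' \<in> J" using pJ[OF that(1) x(1)] Dk x inv by blast
    moreover have "br x (br y x') \<in> J" using pJ[OF that(1) x(2)] JD x by blast
    ultimately show "br y (br x x') \<in> J" using J by (simp add: subspace_add)
  qed
  define I where "I = {x + d | x d. x \<in> J \<and> d \<in> D}"
  have sI: "subspace I" unfolding I_def using subspace_sums[OF J(1) sD] .
  have "br u w \<in> I" if w: "w \<in> I" for u w
  proof -
    obtain x d where x: "x \<in> J" "d \<in> D" "w = x + d" using w by (auto simp: I_def)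
    have "br u w = (br (kproj u) x + br (pproj u) d) + (br (pproj u) x + br (kproj u) d)"
      using split[of u] x(3) by (metis (no_types, lifting) br.add_left br.add_right add.assoc add.commute add.left_commute)
    moreover have "br (kproj u) x + br (pproj u) d \<in> J"
      using inv pD x kproj_in pproj_in J(1) by (simp add: subspace_add)
    moreover have "br (pproj u) x + br (kproj u) d \<in> D"
      using pJ kD x kproj_in pproj_in sD by (simp add: subspace_add)
    ultimately show ?thesis unfolding I_def by blast
  qed
  then have "ideal_of br UNIV I" using sI by (simp add: ideal_of_def)
  then have "I = {0} \<or> I = UNIV" using simple by (simp add: simple_alg_def)
  then show ?thesis
  proof
    assume I: "I = {0}"
    have "x \<in> I" if "x \<in> J" for x using that subspace_0[OF sD] unfolding I_def by force
    then show ?thesis using I subspace_0[OF J(1)] by auto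
  next
    assume I: "I = UNIV"
    have "y \<in> J" if y: "y \<in> p" for y
    proof -
      have "y \<in> I" using I by simp
      then obtain x d where x: "x \<in> J" "d \<in> D" "y = x + d" unfolding I_def by blast
      then have "pproj y = x" using J Dk by (auto simp: linear_add[OF linear_pproj] pproj_p pproj_k subset_iff)
      then show ?thesis using x y by (simp add: pproj_p)
    qed
    then show ?thesis using J by blast
  qed
qed

text \<open>Faithfulness of k on p: the elements of k that annihilate p form an ideal of the whole
  algebra, and it is proper because p is nonzero. This is the source of the strict bound \<kappa> <
  1.\<close>

lemma centralizer_p:
  assumes "u \<in> k" "\<And>y. y \<in> p \<Longrightarrow> br u y = 0"
  shows "u = 0"
proof -
  define C where "C = {u\<in>k. \<forall>y\<in>p. br u y = 0}"
  have "subspace C" using sub_k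
    by (auto simp: C_def subspace_def br.zero_left br.add_left br.scaleR_left)
  moreover have "br x u \<in> C" if u: "u \<in> C" for x u
  proof -
    have "br (pproj x) u = 0" using u br_anti[of "pproj x" u] pproj_in by (simp add: C_def)
    then have "br x u = br (kproj x) u" using split[of x] by (metis br.add_left add.right_neutral)
    then show ?thesis using u kproj_in[of x] br_kk br_kp by (auto simp: C_def br_br br.zero_right)
  qed
  ultimately have "ideal_of br UNIV C" by (simp add: ideal_of_def)
  then have "C = {0} \<or> C = UNIV" using simple by (simp add: simple_alg_def)
  moreover have "C \<noteq> UNIV" using noncompact kp_int subspace_0[OF sub_p] by (auto simp: C_def)
  ultimately show ?thesis using assms by (auto simp: C_def)
qed

end

section \<open>Ricci curvature\<close>

text \<open>The symmetrised trace form of \<open>A\<close> on p: on the diagonal, twice the trace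
  over p of ad Y A ad Y. For \<open>A = kproj\<close> it is B on p, by
  \<open>killing_split_p\<close>.\<close>

definition (in cartan) tau :: "('v \<Rightarrow> 'v) \<Rightarrow> 'v \<Rightarrow> 'v \<Rightarrow> real" where
  "tau A Y Z = trace_on p (\<lambda>X. br Y (A (br Z X))) + trace_on p (\<lambda>X. br Z (A (br Y X)))"

text \<open>The metrics \<open>\<beta> (B on p) + (- \<beta> B(L \<cdot>, \<cdot>) on k)\<close>; the operator \<open>L\<close> is extended by zero to \<open>p\<close>.\<close>

locale cartan_metric = cartan br k p
  for br :: "'v::euclidean_space \<Rightarrow> 'v \<Rightarrow> 'v" and k p +
  fixes L :: "'v \<Rightarrow> 'v" and \<beta> :: real
  assumes linear_L: "linear L"
    and L_in: "L X \<in> k"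
    and L_p: "X \<in> p \<Longrightarrow> L X = 0"
    and L_sym: "Q (L X) Y = Q X (L Y)"
    and L_br: "U \<in> k \<Longrightarrow> L (br U X) = br U (L X)"
    and L_pos: "X \<in> k \<Longrightarrow> X \<noteq> 0 \<Longrightarrow> Q (L X) X > 0"
    and \<beta>_pos: "\<beta> > 0"
begin

section \<open>The Levi-Civita connection of an invariant metric\<close>

definition met :: "'v \<Rightarrow> 'v \<Rightarrow> real" where
  "met X Y = \<beta> * (Q (pproj X) (pproj Y) + Q (L X) Y)"

text \<open>\<open>conn X Y\<close> will turn out to be the Levi-Civita connection \<open>\<nabla>\<^sub>X Y\<close>.\<close>

definition conn :: "'v \<Rightarrow> 'v \<Rightarrow> 'v" where
  "conn X Y = (1/2) *\<^sub>R br (kproj X) (kproj Y) + (1/2) *\<^sub>R br (pproj X) (pproj Y)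
     + br (kproj X + (1/2) *\<^sub>R L X) (pproj Y) - (1/2) *\<^sub>R br (pproj X) (L Y)"

lemmas L_simps = linear_add[OF linear_L] linear_diff[OF linear_L] linear_cmul[OF linear_L] linear_0[OF linear_L]
lemmas proj_simps = linear_add[OF linear_kproj] linear_diff[OF linear_kproj] linear_cmul[OF linear_kproj]
  linear_add[OF linear_pproj] linear_diff[OF linear_pproj] linear_cmul[OF linear_pproj]
lemmas in_kp = kproj_in pproj_in L_in br_kk br_kp br_pk br_pp
lemmas proj_ids = kproj_k kproj_p pproj_k pproj_p
lemmas br_simps = br.add_left br.add_right br.diff_left br.diff_right br.scaleR_left br.scaleR_right
  br.minus_left br.minus_right br.zero_left br.zero_right

lemma L_kproj: "L (kproj X) = L X"
proof -
  have "L X = L (kproj X + pproj X)" by (simp flip: split)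
  then show ?thesis by (simp add: L_simps L_p pproj_in)
qed

lemma conn_k: "kproj (conn X Y) = (1/2) *\<^sub>R br (kproj X) (kproj Y) + (1/2) *\<^sub>R br (pproj X) (pproj Y)"
  and conn_p: "pproj (conn X Y) = br (kproj X + (1/2) *\<^sub>R L X) (pproj Y) - (1/2) *\<^sub>R br (pproj X) (L Y)"
  by (simp_all add: conn_def proj_simps br_simps in_kp proj_ids)

lemma br_split: "br X Y = br (kproj X) (kproj Y) + br (pproj X) (pproj Y)
    + (br (kproj X) (pproj Y) + br (pproj X) (kproj Y))"
proof -
  have "br X Y = br (kproj X + pproj X) (kproj Y + pproj Y)" by (simp flip: split)
  then show ?thesis by (simp add: br_simps)
qed

lemma br_split_k: "kproj (br X Y) = br (kproj X) (kproj Y) + br (pproj X) (pproj Y)"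
  and br_split_p: "pproj (br X Y) = br (kproj X) (pproj Y) + br (pproj X) (kproj Y)"
  by (subst br_split, simp add: proj_simps in_kp proj_ids)+

lemma met_eq: "met X Y = \<beta> * (KF (pproj X) (pproj Y) - KF (kproj X) (L Y))"
proof -
  have "Q (L X) Y = Q (kproj X) (L Y)" by (simp flip: L_sym add: L_kproj)
  then show ?thesis by (simp add: met_def Q_p pproj_in Q_k kproj_in)
qed

lemma L_killing: "KF (L X) (kproj Y) = KF (kproj X) (L Y)"
  using L_sym[of X "kproj Y"] L_sym[of "kproj X" "kproj Y"]
  by (simp add: Q_k L_in kproj_in L_kproj)

sublocale met: sym_form met
proof -
  have "bilinear met"
    unfolding bilinear_def
    by (auto intro!: linearI simp: met_eq proj_simps L_simps B.add_left B.add_right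
        B.scaleR_left B.scaleR_right algebra_simps)
  moreover have "met X Y = met Y X" for X Y
    using L_killing[of X Y] by (simp add: met_eq B.sym[of "L X" "kproj Y"] B.sym[of "pproj X" "pproj Y"])
  ultimately show "sym_form met"
    by (simp add: sym_form_def sym_form_axioms_def bilinear_conv_bounded_bilinear)
qed

lemma met_pos: "X \<noteq> 0 \<Longrightarrow> met X X > 0"
proof -
  assume "X \<noteq> 0"
  then have "kproj X \<noteq> 0 \<or> pproj X \<noteq> 0" using split[of X] by auto
  moreover have "KF (pproj X) (pproj X) > 0" if "pproj X \<noteq> 0" using that p_posdef pproj_in by blast
  moreover have "KF (kproj X) (L X) < 0" if "kproj X \<noteq> 0"
    using L_pos[OF kproj_in that] by (simp add: L_kproj Q_k kproj_in L_in B.sym)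
  moreover have "KF (pproj X) (pproj X) \<ge> 0" 
    using calculation(2) by (cases "pproj X = 0") (auto simp: B.zero_left)
  moreover have "KF (kproj X) (L X) \<le> 0" 
    using calculation(3) by (cases "kproj X = 0") (auto simp: B.zero_left)
  ultimately show ?thesis using \<beta>_pos unfolding met_eq by (intro mult_pos_pos) linarith+
qed

lemma killing_cyc: "KF (br X Y) Z = KF (br Y Z) X"
  using killing_inv[of X Y Z] B.sym[of X "br Y Z"] by simp

lemma killing_anti: "KF (br X Y) Z = - KF (br Y X) Z"
  by (subst br_anti) (simp add: B.minus_left)

text \<open>Both sides are expanded along k and p. The terms with all arguments in k agree because
  \<open>L\<close> commutes with ad k, which makes B([x,y], L w) invariant under cyclic permutation
  (\<open>L1\<close>, \<open>L2\<close>); the mixed terms are matched by cyclicity and antisymmetry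
  of B([x,y], z), collected in \<open>c\<close>.\<close>

lemma koszul: "met (conn X Y) W = (met (br X Y) W - met (br Y W) X + met (br W X) Y) / 2"
proof -
  define x x' y y' w w' where d: "x = kproj X" "x' = pproj X" "y = kproj Y" "y' = pproj Y"
    "w = kproj W" "w' = pproj W"
  have 1: "met (br X Y) W = \<beta> * (KF (br x y') w' + KF (br x' y) w' - KF (br x y) (L W) - KF (br x' y') (L W))"
    and 2: "met (br Y W) X = \<beta> * (KF (br y w') x' + KF (br y' w) x' - KF (br y w) (L X) - KF (br y' w') (L X))"
    and 3: "met (br W X) Y = \<beta> * (KF (br w x') y' + KF (br w' x) y' - KF (br w x) (L Y) - KF (br w' x') (L Y))"
    by (simp_all add: met_eq br_split_p br_split_k B.add_left d)
  have 4: "met (conn X Y) W = \<beta> * (KF (br x y') w' + (1/2) * KF (br (L X) y') w' - (1/2) * KF (br x' (L Y)) w'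
     - (1/2) * KF (br x y) (L W) - (1/2) * KF (br x' y') (L W))"
    by (simp add: met_eq conn_k conn_p B.add_left B.diff_left B.scaleR_left br_simps d algebra_simps)
  have L1: "KF (br x y) (L W) = KF (br y w) (L X)"
  proof -
    have "KF (br x y) (L W) = KF (L (br x y)) w"
      using L_killing[of "br x y" W] by (simp add: d kproj_k in_kp)
    also have "L (br x y) = - br y (L X)"
      by (subst br_anti) (simp add: d L_br L_kproj in_kp L_simps linear_neg[OF linear_L])
    also have "KF (- br y (L X)) w = KF (br (L X) y) w" by (subst (2) br_anti) (rule refl)
    finally show ?thesis by (simp add: killing_cyc[of "L X"])
  qed
  have L2: "KF (br x y) (L W) = KF (br w x) (L Y)"
  proof -
    have "KF (br x y) (L W) = KF (L (br x y)) w"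
      using L_killing[of "br x y" W] by (simp add: d kproj_k in_kp)
    also have "L (br x y) = br x (L Y)" by (simp add: d L_br L_kproj in_kp)
    also have "KF (br x (L Y)) w = KF (br w x) (L Y)" by (rule killing_cyc[symmetric])
    finally show ?thesis .
  qed
  have c: "KF (br y w') x' = KF (br x' y) w'" "KF (br y' w) x' = - KF (br w y') x'"
    "KF (br w x') y' = - KF (br w y') x'" "KF (br w' x) y' = KF (br x y') w'"
    "KF (br y' w') (L X) = KF (br (L X) y') w'" "KF (br w' x') (L Y) = KF (br x' (L Y)) w'"
    using killing_cyc[of x' y w'] killing_anti[of y' w x'] killing_cyc[of w x' y'] killing_cyc[of x' y' w]
      killing_cyc[of w' x y'] killing_cyc[of "L X" y' w'] killing_cyc[of w' x' "L Y"] by linarith+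
  show ?thesis unfolding 1 2 3 4 using L1 L2 c by (simp add: algebra_simps)
qed

lemma levi_conn: "levi br met = conn"
proof (intro ext)
  fix X Y
  show "levi br met X Y = conn X Y"
    unfolding levi_def
  proof (rule the_equality)
    show "\<forall>W. met (conn X Y) W = (met (br X Y) W - met (br Y W) X + met (br W X) Y) / 2"
      using koszul by blast
    fix v assume "\<forall>W. met v W = (met (br X Y) W - met (br Y W) X + met (br W X) Y) / 2"
    then have "met v W = met (conn X Y) W" for W using koszul by metis
    then have "met (v - conn X Y) (v - conn X Y) = 0" by (simp add: met.diff_left)
    then show "v = conn X Y" using met_pos[of "v - conn X Y"] by force
  qed
qed

lemma linear_conn: "linear (conn X)" and linear_conn_left: "linear (\<lambda>X. conn X Y)"
  by (auto intro!: linearI simp: conn_def br_simps proj_simps L_simps algebra_simps)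

lemma torsion_free: "conn X Y - conn Y X = br X Y"
proof -
  have 1: "br (kproj Y) (kproj X) = - br (kproj X) (kproj Y)" "br (pproj Y) (pproj X) = - br (pproj X) (pproj Y)"
    "br (kproj Y) (pproj X) = - br (pproj X) (kproj Y)" "br (L Y) (pproj X) = - br (pproj X) (L Y)"
    "br (pproj Y) (L X) = - br (L X) (pproj Y)"
    by (rule br_anti)+
  have h: "(1/2) *\<^sub>R a + (1/2) *\<^sub>R a = a" for a :: 'v by (simp flip: scaleR_add_left)
  show ?thesis
    unfolding conn_def br_simps 1 by (subst br_split) (simp add: h algebra_simps)
qed

text \<open>The divergence of every left-invariant field vanishes, since \<open>conn W\<close> is skew and \<open>g\<close> unimodular.\<close>

lemma trace_conn_left: "trace (\<lambda>X. conn X W) = 0"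
proof -
  have "met (conn W x) x = 0" for x
  proof -
    have "met (br x x) W = - met (br x x) W" "met (br x W) x = - met (br W x) x"
      by (metis br_anti met.minus_left)+
    then show ?thesis using koszul[of W x x] by simp
  qed
  then have "trace_on UNIV (conn W) = 0"
    using met.trace_on_skew[OF subspace_UNIV met_pos linear_conn] by blast
  then have "trace (conn W) = 0" by (simp add: trace_eq_trace_on linear_conn)
  moreover have "(\<lambda>X. conn X W) = (\<lambda>X. conn W X - br W X)"
    by (rule ext) (metis torsion_free diff_diff_eq2 add_diff_cancel_left' diff_eq_eq)
  ultimately show ?thesis by (simp add: trace_diff trace_ad)
qed

text \<open>Torsion freeness replaces the derivative along [X,Y] by two terms. One cancels against
  \<open>conn Y (conn X Z)\<close> by cyclicity of the trace, the other is the one that remains; the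
  first term of the curvature traces to the divergence of \<open>conn Y Z\<close>, which is
  zero.\<close>

lemma ricci_eq_trace: "ricci br met Y Z = - trace (\<lambda>X. conn (conn X Y) Z)"
proof -
  have "curv br met X Y Z = conn X (conn Y Z) - conn Y (conn X Z) - (conn (conn X Y) Z - conn (conn Y X) Z)" for X
    by (simp add: curv_def levi_conn linear_diff[OF linear_conn_left] flip: torsion_free[of X Y])
  then have "ricci br met Y Z = trace (\<lambda>X. conn X (conn Y Z)) - trace (\<lambda>X. conn Y (conn X Z))
      - (trace (\<lambda>X. conn (conn X Y) Z) - trace (\<lambda>X. conn (conn Y X) Z))"
    by (simp add: ricci_def trace_diff)
  also have "trace (\<lambda>X. conn Y (conn X Z)) = trace (\<lambda>X. conn (conn Y X) Z)"
    using trace_commute[OF linear_conn_left[of Z] linear_conn[of Y]] .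
  finally show ?thesis by (simp add: trace_conn_left)
qed

text \<open>Only the diagonal blocks of the operator count (\<open>K\<close>, \<open>Pp\<close>),
  and in them \<open>y\<close> pairs only with \<open>z\<close> and \<open>y'\<close> only with
  \<open>z'\<close>, so k and p do not mix. Moving the traces over k with p-arguments to p completes
  the two halves of B and of \<open>tau L\<close>.\<close>

lemma ricci_met: "ricci br met Y Z = - killing_on br k (kproj Y) (kproj Z) / 4
   - killing_on br p (L Y) (L Z) / 4 - KF (pproj Y) (pproj Z) / 2 - tau L (pproj Y) (pproj Z) / 4"
proof -
  define y y' z z' where d: "y = kproj Y" "y' = pproj Y" "z = kproj Z" "z' = pproj Z"
  have in_y: "y \<in> k" "y' \<in> p" "z \<in> k" "z' \<in> p" by (simp_all add: d in_kp)
  have K: "kproj (conn (conn X Y) Z) =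
      (1/4) *\<^sub>R br z (br y X) + (1/2) *\<^sub>R br z' (br y' X) + (1/4) *\<^sub>R br z' (br y' (L X))" if X: "X \<in> k" for X
  proof -
    have "kproj (conn X Y) = (1/2) *\<^sub>R br X y" "pproj (conn X Y) = br (X + (1/2) *\<^sub>R L X) y'"
      using X by (simp_all add: conn_k conn_p proj_ids br_simps d)
    then have "kproj (conn (conn X Y) Z) = (1/4) *\<^sub>R br (br X y) z + (1/2) *\<^sub>R br (br X y') z'
        + (1/4) *\<^sub>R br (br (L X) y') z'"
      by (simp add: conn_k[of "conn X Y"] br_simps algebra_simps flip: d)
    moreover have "br (br V a) b = br b (br a V)" for V a b
      by (subst br_anti, subst (2) br_anti) (simp add: br_simps)
    ultimately show ?thesis by simp
  qed
  have Pp: "pproj (conn (conn X Y) Z) =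
      (1/2) *\<^sub>R br z' (br y' X) + (1/4) *\<^sub>R br z' (L (br y' X)) + (1/4) *\<^sub>R br (L Z) (br (L Y) X)" if X: "X \<in> p" for X
  proof -
    have k: "kproj (conn X Y) = (1/2) *\<^sub>R br X y'" and "pproj (conn X Y) = - ((1/2) *\<^sub>R br X (L Y))"
      using X by (simp_all add: conn_k conn_p proj_ids br_simps L_p d)
    moreover have "L (conn X Y) = (1/2) *\<^sub>R L (br X y')"
      by (subst L_kproj[symmetric]) (simp add: k L_simps)
    ultimately have "pproj (conn (conn X Y) Z) = (1/2) *\<^sub>R br (br X y') z' + (1/4) *\<^sub>R br (L (br X y')) z'
        + (1/4) *\<^sub>R br (br X (L Y)) (L Z)"
      by (simp add: conn_p[of "conn X Y"] br_simps algebra_simps flip: d)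
    moreover have "br (br V a) b = br b (br a V)" for V a b
      by (subst br_anti, subst (2) br_anti) (simp add: br_simps)
    moreover have "br (L (br V a)) b = br b (L (br a V))" for V a b
      by (subst br_anti, subst (2) br_anti) (simp add: br_simps linear_neg[OF linear_L])
    ultimately show ?thesis by simp
  qed
  have lin: "linear (\<lambda>X. conn (conn X Y) Z)"
    using linear_compose[OF linear_conn_left linear_conn_left] by (simp add: o_def)
  have "trace (\<lambda>X. conn (conn X Y) Z) =
     trace_on k (\<lambda>X. (1/4) *\<^sub>R br z (br y X) + (1/2) *\<^sub>R br z' (br y' X) + (1/4) *\<^sub>R br z' (br y' (L X)))
   + trace_on p (\<lambda>X. (1/2) *\<^sub>R br z' (br y' X) + (1/4) *\<^sub>R br z' (L (br y' X)) + (1/4) *\<^sub>R br (L Z) (br (L Y) X))"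
    unfolding trace_split[OF lin]
    using trace_on_cong[OF sub_k K] trace_on_cong[OF sub_p Pp] by simp
  moreover have "trace_on k (\<lambda>X. br z' (br y' X)) = trace_on p (\<lambda>X. br y' (br z' X))"
    using trace_on_commute[OF sub_k sub_p linear_ad[of y'] linear_ad[of z']] in_y br_pp br_pk by blast
  moreover have "trace_on k (\<lambda>X. br z' (br y' (L X))) = trace_on p (\<lambda>X. br y' (L (br z' X)))"
    using trace_on_commute[OF sub_k sub_p linear_compose[OF linear_L linear_ad[of y']] linear_ad[of z']]
      in_y br_pp br_pk L_in by (simp add: o_def)
  moreover have "KF y' z' = trace_on p (\<lambda>X. br y' (br z' X)) + trace_on p (\<lambda>X. br z' (br y' X))"
    by (rule killing_split_p) (use in_y in auto)
  moreover have "killing_on br k y z = killing_on br k z y"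
    by (rule killing_on_sym) (use in_y sub_k br_kk in auto)
  moreover have "killing_on br p (L Y) (L Z) = killing_on br p (L Z) (L Y)"
    by (rule killing_on_sym) (use L_in sub_p br_kp in auto)
  ultimately show ?thesis
    unfolding ricci_eq_trace tau_def d[symmetric]
    by (simp add: trace_on_add trace_on_scale killing_on_def field_simps)
qed

end

section \<open>Orthogonal ideals of the compact part\<close>

text \<open>This isolates what the curvature computation uses: nonzero, mutually orthogonal ideals
  that span k, on each of which the Killing form of k is a multiple of B. Simple ideals and the
  centre, where the multiple is 0, are then treated alike.\<close>

locale cartan_decomp = cartan br k p
  for br :: "'v::euclidean_space \<Rightarrow> 'v \<Rightarrow> 'v" and k p +
  fixes ks :: "nat \<Rightarrow> 'v set" and m :: nat and \<kappa> :: "nat \<Rightarrow> real"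
  assumes sub_ks: "i \<in> {1..m} \<Longrightarrow> subspace (ks i)"
    and ks_k: "i \<in> {1..m} \<Longrightarrow> ks i \<subseteq> k"
    and ks_ideal: "i \<in> {1..m} \<Longrightarrow> u \<in> k \<Longrightarrow> x \<in> ks i \<Longrightarrow> br u x \<in> ks i"
    and ks_nontrivial: "i \<in> {1..m} \<Longrightarrow> ks i \<noteq> {0}"
    and ks_orth: "i \<in> {1..m} \<Longrightarrow> j \<in> {1..m} \<Longrightarrow> i \<noteq> j \<Longrightarrow> x \<in> ks i \<Longrightarrow> y \<in> ks j \<Longrightarrow> KF x y = 0"
    and ks_span: "k \<subseteq> span (\<Union>i\<in>{1..m}. ks i)"
    and ks_kappa: "i \<in> {1..m} \<Longrightarrow> x \<in> ks i \<Longrightarrow> y \<in> ks i \<Longrightarrow> killing_on br k x y = \<kappa> i * KF x y"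
begin

abbreviation "P i \<equiv> qproj Q (ks i)"

context
  fixes i assumes i: "i \<in> {1..m}"
begin

lemma linear_P: "linear (P i)" by (rule Q.qproj_linear[OF sub_ks[OF i] Q_pos])

lemma P_in: "P i X \<in> ks i" by (rule Q.qproj_in[OF sub_ks[OF i] Q_pos])

lemma P_k: "P i X \<in> k" using P_in ks_k[OF i] by blast

lemma P_ident: "X \<in> ks i \<Longrightarrow> P i X = X" by (rule Q.qproj_ident[OF sub_ks[OF i] Q_pos])

lemma P_orth: "w \<in> ks i \<Longrightarrow> Q (X - P i X) w = 0" by (rule Q.qproj_orth[OF sub_ks[OF i] Q_pos])

lemma P_sym2: "Q (P i X) (P i Y) = Q (P i X) Y"
  using P_orth[OF P_in, of Y X] Q.sym[of "P i X"] by (simp add: Q.diff_left)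

lemma P_sym: "Q (P i X) Y = Q X (P i Y)"
  using P_sym2[of X Y] P_sym2[of Y X] Q.sym by metis

lemma P_p: "X \<in> p \<Longrightarrow> P i X = 0"
  using ks_k[OF i] subspace_0[OF sub_ks[OF i]]
  by (intro Q.qproj_eqI[OF sub_ks[OF i] Q_pos]) (auto simp: Q_kp subset_iff)

text \<open>Since ad k is \<open>Q\<close>-skew, it preserves the orthogonal complement of the ideal
  \<open>ks i\<close> as well.\<close>

lemma P_br: "U \<in> k \<Longrightarrow> P i (br U X) = br U (P i X)"
  using ks_ideal[OF i] P_in P_orth
  by (intro Q.qproj_eqI[OF sub_ks[OF i] Q_pos]) (auto simp: Q_skew simp flip: br.diff_right)

lemma P_other: 
  assumes "j \<in> {1..m}" "j \<noteq> i" "X \<in> ks j"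
  shows "P i X = 0"
proof (rule Q.qproj_eqI[OF sub_ks[OF i] Q_pos subspace_0[OF sub_ks[OF i]]])
  fix w assume "w \<in> ks i"
  then show "Q (X - 0) w = 0" using ks_orth[OF assms(1) i assms(2,3)] ks_k[OF assms(1)] assms(3)
    by (auto simp: Q_k)
qed

end

text \<open>The difference of the two sides lies in k and is \<open>Q\<close>-orthogonal to every
  \<open>ks j\<close>, hence to their span, hence to itself.\<close>

lemma kproj_sum: "kproj X = (\<Sum>i\<in>{1..m}. P i X)"
proof -
  define D where "D = kproj X - (\<Sum>i\<in>{1..m}. P i X)"
  have D: "D \<in> k" unfolding D_def
    by (intro subspace_diff subspace_sum sub_k kproj_in P_k)
  have orth: "Q D w = 0" if j: "j \<in> {1..m}" and w: "w \<in> ks j" for j w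
  proof -
    have "Q (\<Sum>i\<in>{1..m}. P i X) w = (\<Sum>i\<in>{1..m}. Q (P i X) w)" by (rule Q.sum_left)
    also have "\<dots> = (\<Sum>i\<in>{1..m}. if i = j then Q (P j X) w else 0)"
    proof (rule sum.cong[OF refl])
      fix i assume i: "i \<in> {1..m}"
      show "Q (P i X) w = (if i = j then Q (P j X) w else 0)"
        using P_sym[OF i, of X w] P_other[OF i j] w by (auto simp: Q.zero_right)
    qed
    also have "\<dots> = Q (P j X) w" using j by simp
    also have "\<dots> = Q (kproj X + pproj X) w"
      using P_sym[OF j, of X w] P_ident[OF j w] split[of X] by simp
    also have "\<dots> = Q (kproj X) w"
      using Q_kp(2)[of w "pproj X"] ks_k[OF j] w pproj_in by (auto simp: Q.add_left)
    finally have "Q (\<Sum>i\<in>{1..m}. P i X) w = Q (kproj X) w" .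
    then show ?thesis unfolding D_def Q.diff_left by linarith
  qed
  have "subspace {w. Q D w = 0}"
    by (auto simp: subspace_def Q.zero_right Q.add_right Q.scaleR_right)
  then have "span (\<Union>i\<in>{1..m}. ks i) \<subseteq> {w. Q D w = 0}"
    using orth by (intro span_minimal) auto
  then have "Q D D = 0" using ks_span D by blast
  then have "D = 0" using Q_pos[of D] by force
  then show ?thesis by (simp add: D_def)
qed

text \<open>The bracket lies in both ideals, so it is B-orthogonal to itself, and B is definite on
  k.\<close>

lemma br_other:
  assumes "i \<in> {1..m}" "j \<in> {1..m}" "i \<noteq> j" "x \<in> ks i" "y \<in> ks j"
  shows "br x y = 0"
proof (rule ccontr)
  assume n: "br x y \<noteq> 0"
  have "br x y \<in> ks j" using assms ks_k[of i] ks_ideal[of j x y] by blast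
  moreover have "br y x \<in> ks i" using assms ks_k[of j] ks_ideal[of i y x] by blast
  then have "br x y \<in> ks i" using br_anti[of x y] subspace_neg[OF sub_ks[OF assms(1)]] by metis
  ultimately have "KF (br x y) (br x y) = 0" using ks_orth assms by blast
  then show False using k_negdef n \<open>br x y \<in> ks j\<close> ks_k[OF assms(2)] by fastforce
qed

lemma killing_on_other:
  assumes "i \<in> {1..m}" "j \<in> {1..m}" "i \<noteq> j" "x \<in> ks i" "y \<in> ks j"
  shows "killing_on br k x y = 0"
proof -
  have "br x (br y W) = 0" if W: "W \<in> k" for W
  proof -
    have "br W y \<in> ks j" using assms W ks_ideal by blast
    then have "br y W \<in> ks j" using br_anti[of y W] subspace_neg[OF sub_ks[OF assms(2)]] by metis
    then show ?thesis using br_other assms by blast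
  qed
  then have "killing_on br k x y = trace_on k (\<lambda>W. 0)"
    unfolding killing_on_def by (intro trace_on_cong sub_k)
  then show ?thesis by (simp add: trace_on_zero)
qed

lemma sum_diagonal:
  fixes b :: "'v \<Rightarrow> 'v \<Rightarrow> real"
  assumes b: "bounded_bilinear b"
    and off: "\<And>i j x y. i \<in> {1..m} \<Longrightarrow> j \<in> {1..m} \<Longrightarrow> i \<noteq> j \<Longrightarrow> x \<in> ks i \<Longrightarrow> y \<in> ks j \<Longrightarrow> b x y = 0"
    and YZ: "Y \<in> k" "Z \<in> k"
  shows "b Y Z = (\<Sum>i\<in>{1..m}. b (P i Y) (P i Z))"
proof -
  interpret bounded_bilinear b by fact
  have "b Y Z = b (\<Sum>i\<in>{1..m}. P i Y) (\<Sum>j\<in>{1..m}. P j Z)"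
    using YZ by (simp only: kproj_k kproj_sum[symmetric])
  also have "\<dots> = (\<Sum>i\<in>{1..m}. \<Sum>j\<in>{1..m}. b (P i Y) (P j Z))"
    by (simp only: sum_left sum_right) (rule sum.swap)
  also have "\<dots> = (\<Sum>i\<in>{1..m}. \<Sum>j\<in>{1..m}. if j = i then b (P i Y) (P i Z) else 0)"
  proof (intro sum.cong refl)
    fix i j assume "i \<in> {1..m}" "j \<in> {1..m}"
    then show "b (P i Y) (P j Z) = (if j = i then b (P i Y) (P i Z) else 0)"
      using off[of i j "P i Y" "P j Z"] P_in by auto
  qed
  finally show ?thesis by simp
qed

lemma killing_diagonal:
  "Y \<in> k \<Longrightarrow> Z \<in> k \<Longrightarrow> KF Y Z = (\<Sum>i\<in>{1..m}. KF (P i Y) (P i Z))"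
  by (rule sum_diagonal[OF B.bounded_bilinear_axioms ks_orth])

lemma killing_on_k_diagonal:
  assumes "Y \<in> k" "Z \<in> k"
  shows "killing_on br k Y Z = (\<Sum>i\<in>{1..m}. \<kappa> i * KF (P i Y) (P i Z))"
proof -
  have "killing_on br k Y Z = (\<Sum>i\<in>{1..m}. killing_on br k (P i Y) (P i Z))"
    by (rule sum_diagonal[OF bounded_bilinear_killing_on killing_on_other assms])
  also have "\<dots> = (\<Sum>i\<in>{1..m}. \<kappa> i * KF (P i Y) (P i Z))"
    by (intro sum.cong refl ks_kappa P_in)
  finally show ?thesis .
qed

lemma killing_on_p_diagonal:
  assumes "Y \<in> k" "Z \<in> k"
  shows "killing_on br p Y Z = (\<Sum>i\<in>{1..m}. (1 - \<kappa> i) * KF (P i Y) (P i Z))"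
  using killing_split[OF assms] killing_diagonal[OF assms] killing_on_k_diagonal[OF assms]
  by (simp add: algebra_simps sum_subtractf)

subsection \<open>Dimension counts\<close>

lemma killing_on_p_ks: "i \<in> {1..m} \<Longrightarrow> x \<in> ks i \<Longrightarrow> y \<in> ks i \<Longrightarrow> killing_on br p x y = (1 - \<kappa> i) * KF x y"
  using killing_split[of x y] ks_kappa[of i x y] subsetD[OF ks_k[of i]] by (simp add: left_diff_distrib)

lemma dim_frame:
  assumes "subspace S" "frame Q S E" shows "(\<Sum>e\<in>E. Q e e) = real (dim S)"
  using trace_on_frame[OF assms(2) Q.bounded_bilinear_axioms assms(1) linear_ident] trace_on_ident[OF assms(1)]
  by simp

lemma killing_on_p_frame:
  assumes F: "frame Q p F" and x: "x \<in> k"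
  shows "killing_on br p x x = - (\<Sum>f\<in>F. Q (br x f) (br x f))"
proof -
  have "killing_on br p x x = (\<Sum>f\<in>F. Q (br x (br x f)) f)"
    unfolding killing_on_def
    using trace_on_frame[OF F Q.bounded_bilinear_axioms sub_p linear_ad2] x br_kp by blast
  then show ?thesis using x by (simp add: Q_skew sum_negf)
qed

text \<open>The trace form of k on p is minus a sum of squared lengths of [x,f], and these cannot
  all vanish because k acts faithfully on p. On \<open>ks i\<close> this negative number is (1 -
  \<kappa>) B(x,x) with B(x,x) < 0.\<close>

lemma kappa_less_1:
  assumes i: "i \<in> {1..m}" shows "\<kappa> i < 1"
proof -
  obtain x where x: "x \<in> ks i" "x \<noteq> 0"
    using ks_nontrivial[OF i] subspace_0[OF sub_ks[OF i]] by blast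
  have xk: "x \<in> k" using x ks_k[OF i] by blast
  obtain F where F: "frame Q p F" using Q.frame_exists[OF sub_p Q_pos] by blast
  have nn: "Q z z \<ge> 0" for z using Q_pos[of z] by (cases "z = 0") (auto simp: Q.zero_left)
  have "killing_on br p x x \<noteq> 0"
  proof
    assume "killing_on br p x x = 0"
    then have "(\<Sum>f\<in>F. Q (br x f) (br x f)) = 0" using killing_on_p_frame[OF F xk] by simp
    then have "\<forall>f\<in>F. Q (br x f) (br x f) = 0"
      using F nn by (subst (asm) sum_nonneg_eq_0_iff) (auto simp: frame_def)
    then have f0: "\<forall>f\<in>F. br x f = 0" using Q_pos by (metis less_irrefl)
    have "br x y = 0" if "y \<in> p" for y
    proof -
      have "br x y = br x (\<Sum>f\<in>F. Q y f *\<^sub>R f)" using F that by (simp add: frame_def)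
      then show ?thesis using f0 by (simp add: br.sum_right br.scaleR_right)
    qed
    then show False using centralizer_p xk x by blast
  qed
  then have "killing_on br p x x < 0"
    using killing_on_p_frame[OF F xk] sum_nonneg[of F "\<lambda>f. Q (br x f) (br x f)"] nn by force
  then have "(1 - \<kappa> i) * KF x x < 0" using killing_on_p_ks[OF i x(1) x(1)] by simp
  moreover have "KF x x < 0" using k_negdef xk x by blast
  ultimately show ?thesis by (simp add: mult_less_0_iff)
qed

lemma tau_combination:
  "tau (\<lambda>X. \<Sum>i\<in>{1..m}. l i *\<^sub>R P i X) Y Z = (\<Sum>i\<in>{1..m}. l i * tau (P i) Y Z)"
  by (simp add: tau_def br.sum_right br.scaleR_right trace_on_sum trace_on_scale sum.distrib distrib_left)

lemma tau_sym: "tau A Y Z = tau A Z Y"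
  by (simp add: tau_def)

text \<open>Infinitesimal invariance under k: as \<open>A\<close> commutes with ad u,
  differentiating the trace along ad u leaves the trace of a commutator, which is zero.\<close>

lemma tau_skew:
  assumes u: "u \<in> k" and Y: "Y \<in> p" and Z: "Z \<in> p" and A: "linear A" "\<And>X. A X \<in> k"
    and comm: "\<And>X. A (br u X) = br u (A X)"
  shows "tau A (br u Y) Z = - tau A Y (br u Z)"
proof -
  define a where "a Y Z = trace_on p (\<lambda>X. br Y (A (br Z X)))" for Y Z
  have *: "a (br u Y) Z + a Y (br u Z) = 0" if Y: "Y \<in> p" and Z: "Z \<in> p" for Y Z
  proof -
    have lin: "linear (\<lambda>X. br Y (A (br Z X)))"
      using linear_compose[OF linear_compose[OF linear_ad A(1)] linear_ad] by (simp add: o_def)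
    have "a (br u Y) Z = trace_on p (\<lambda>X. br u (br Y (A (br Z X)))) - trace_on p (\<lambda>X. br Y (br u (A (br Z X))))"
      by (simp add: a_def br_br trace_on_diff)
    moreover have "a Y (br u Z) = trace_on p (\<lambda>X. br Y (br u (A (br Z X)))) - trace_on p (\<lambda>X. br Y (A (br Z (br u X))))"
      by (simp add: a_def br_br linear_diff[OF A(1)] comm br.diff_right trace_on_diff)
    moreover have "trace_on p (\<lambda>X. br u (br Y (A (br Z X)))) = trace_on p (\<lambda>X. br Y (A (br Z (br u X))))"
      using trace_on_commute[OF sub_p sub_p lin linear_ad[of u]] A(2) br_pk[OF Y] br_kp[OF u] by blast
    ultimately show ?thesis by simp
  qed
  show ?thesis using *[OF Y Z] *[OF Z Y] by (simp add: tau_def flip: a_def)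
qed

lemma dim_p_pos: "dim p > 0"
  using noncompact subspace_0[OF sub_p] by (metis dim_eq_0 gr0I singletonD subset_antisym subsetI)

text \<open>Both sides are sums over frames of the squared structure constants \<open>B([e,f],f')\<close>.\<close>

lemma tau_frame:
  assumes i: "i \<in> {1..m}" and F: "frame Q p F"
  shows "(\<Sum>f\<in>F. tau (P i) f f) = 2 * real (dim (ks i)) * (1 - \<kappa> i)"
proof -
  obtain E where E: "frame Q (ks i) E" using Q.frame_exists[OF sub_ks[OF i] Q_pos] by blast
  have Pi: "P i V = (\<Sum>e\<in>E. Q V e *\<^sub>R e)" for V
    by (rule Q.qproj_frame[OF sub_ks[OF i] Q_pos E])
  have Fp: "f \<in> F \<Longrightarrow> f \<in> p" for f using F by (auto simp: frame_def)
  have Ek: "e \<in> E \<Longrightarrow> e \<in> ks i \<and> e \<in> k" for e using E ks_k[OF i] by (auto simp: frame_def)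
  have 1: "tau (P i) f f = 2 * (\<Sum>f'\<in>F. \<Sum>e\<in>E. (KF (br e f) f')\<^sup>2)" if f: "f \<in> F" for f
  proof -
    have lin: "linear (\<lambda>X. br f (P i (br f X)))"
      using linear_compose[OF linear_compose[OF linear_ad linear_P[OF i]] linear_ad] by (simp add: o_def)
    have "Q (br f (P i (br f f'))) f' = (\<Sum>e\<in>E. (KF (br e f) f')\<^sup>2)" if f': "f' \<in> F" for f'
    proof -
      have "Q (br f (P i (br f f'))) f' = (\<Sum>e\<in>E. Q (br f f') e * Q (br f e) f')"
        unfolding Pi
        by (simp add: br.sum_right br.scaleR_right Q.sum_left Q.scaleR_left)
      also have "\<dots> = (\<Sum>e\<in>E. (KF (br e f) f')\<^sup>2)"
      proof (rule sum.cong[OF refl])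
        fix e assume e: "e \<in> E"
        have "Q (br f f') e = - KF (br f f') e" "Q (br f e) f' = KF (br f e) f'"
          using Ek[OF e] Fp f f' by (auto simp: Q_k Q_p)
        moreover have "KF (br f f') e = KF e (br f f')" by (rule B.sym)
        moreover have "KF e (br f f') = KF (br e f) f'" by (rule killing_inv[symmetric])
        moreover have "KF (br f e) f' = - KF (br e f) f'" by (metis br_anti B.minus_left)
        ultimately show "Q (br f f') e * Q (br f e) f' = (KF (br e f) f')\<^sup>2"
          by (simp add: power2_eq_square)
      qed
      finally show ?thesis .
    qed
    moreover have "trace_on p (\<lambda>X. br f (P i (br f X))) = (\<Sum>f'\<in>F. Q (br f (P i (br f f'))) f')"
      using trace_on_frame[OF F Q.bounded_bilinear_axioms sub_p lin] br_pk[OF Fp[OF f] P_k[OF i]] by blast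
    ultimately show ?thesis by (simp add: tau_def)
  qed
  have 2: "(1 - \<kappa> i) * Q e e = (\<Sum>f\<in>F. \<Sum>f'\<in>F. (KF (br e f) f')\<^sup>2)" if e: "e \<in> E" for e
  proof -
    have ek: "e \<in> ks i" "e \<in> k" using Ek e by auto
    have "(1 - \<kappa> i) * Q e e = - killing_on br p e e"
      using killing_on_p_ks[OF i ek(1) ek(1)] ek by (simp add: Q_k)
    also have "\<dots> = (\<Sum>f\<in>F. Q (br e f) (br e f))"
      using killing_on_p_frame[OF F ek(2)] by simp
    also have "\<dots> = (\<Sum>f\<in>F. \<Sum>f'\<in>F. (KF (br e f) f')\<^sup>2)"
    proof (rule sum.cong[OF refl])
      fix f assume f: "f \<in> F"
      have ef: "br e f \<in> p" using ek Fp[OF f] br_kp by blast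
      then have "br e f = (\<Sum>f'\<in>F. Q (br e f) f' *\<^sub>R f')" using F by (auto simp: frame_def)
      then have "Q (br e f) (br e f) = Q (br e f) (\<Sum>f'\<in>F. Q (br e f) f' *\<^sub>R f')" by simp
      also have "\<dots> = (\<Sum>f'\<in>F. (Q (br e f) f')\<^sup>2)"
        by (simp add: Q.sum_right Q.scaleR_right power2_eq_square)
      finally show "Q (br e f) (br e f) = (\<Sum>f'\<in>F. (KF (br e f) f')\<^sup>2)"
        using ef by (simp add: Q_p)
    qed
    finally show ?thesis .
  qed
  have "2 * real (dim (ks i)) * (1 - \<kappa> i) = 2 * (\<Sum>e\<in>E. (1 - \<kappa> i) * Q e e)"
    by (simp add: dim_frame[OF sub_ks[OF i] E] flip: sum_distrib_left)
  also have "(\<Sum>e\<in>E. (1 - \<kappa> i) * Q e e) = (\<Sum>e\<in>E. \<Sum>f\<in>F. \<Sum>f'\<in>F. (KF (br e f) f')\<^sup>2)"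
    using 2 by (intro sum.cong) auto
  also have "\<dots> = (\<Sum>f\<in>F. \<Sum>e\<in>E. \<Sum>f'\<in>F. (KF (br e f) f')\<^sup>2)" by (rule sum.swap)
  also have "\<dots> = (\<Sum>f\<in>F. \<Sum>f'\<in>F. \<Sum>e\<in>E. (KF (br e f) f')\<^sup>2)"
    by (intro sum.cong[OF refl] sum.swap)
  finally show ?thesis using 1 by (simp add: sum_distrib_left)
qed

text \<open>The form is a multiple of B on p by invariance and irreducibility; summing it over a
  \<open>Q\<close>-frame of p compares that multiple of dim p with the value from
  \<open>tau_frame\<close>.\<close>

lemma tau_eq:
  assumes i: "i \<in> {1..m}" and Y: "Y \<in> p" and Z: "Z \<in> p"
  shows "tau (P i) Y Z = 2 * real (dim (ks i)) * (1 - \<kappa> i) / real (dim p) * KF Y Z"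
proof -
  define \<sigma> where "\<sigma> Y Z = tau (P i) (pproj Y) (pproj Z)" for Y Z
  have "bilinear \<sigma>"
    unfolding bilinear_def \<sigma>_def tau_def
    by (auto intro!: linearI simp: linear_add[OF linear_pproj] linear_cmul[OF linear_pproj]
        linear_add[OF linear_P[OF i]] linear_cmul[OF linear_P[OF i]] br.add_left br.add_right
        br.scaleR_left br.scaleR_right trace_on_add trace_on_scale algebra_simps)
  then have \<sigma>: "sym_form \<sigma>"
    by (simp add: sym_form_def sym_form_axioms_def bilinear_conv_bounded_bilinear \<sigma>_def tau_sym)
  have "\<exists>c. \<forall>x\<in>p. \<forall>y\<in>p. \<sigma> x y = c * Q x y"
  proof (rule schur_symmetric_form[where \<phi> = br and K = k, OF Q.sym_form_axioms \<sigma> sub_p noncompact Q_pos])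
    show "\<sigma> (br u x) y = - \<sigma> x (br u y)" if "u \<in> k" "x \<in> p" "y \<in> p" for u x y
      using tau_skew[OF that linear_P[OF i] P_k[OF i] P_br[OF i]] that
      by (simp add: \<sigma>_def pproj_p br_kp)
  qed (use br_kp Q_skew p_irreducible in blast)+
  then obtain c where c: "\<And>x y. x \<in> p \<Longrightarrow> y \<in> p \<Longrightarrow> tau (P i) x y = c * KF x y"
    unfolding \<sigma>_def by (auto simp: pproj_p Q_p)
  obtain F where F: "frame Q p F" using Q.frame_exists[OF sub_p Q_pos] by blast
  have "(\<Sum>f\<in>F. tau (P i) f f) = (\<Sum>f\<in>F. c * Q f f)"
    using F c by (intro sum.cong) (auto simp: frame_def Q_p)
  also have "\<dots> = c * real (dim p)"
    by (simp add: dim_frame[OF sub_p F] flip: sum_distrib_left)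
  finally have "c * real (dim p) = 2 * real (dim (ks i)) * (1 - \<kappa> i)"
    using tau_frame[OF i F] by simp
  then have "c = 2 * real (dim (ks i)) * (1 - \<kappa> i) / real (dim p)"
    using dim_p_pos by (metis nonzero_mult_div_cancel_right of_nat_0_eq_iff less_irrefl)
  then show ?thesis using c[OF Y Z] by simp
qed

text \<open>On p one has B = \<open>tau kproj\<close>, and \<open>kproj\<close> is the sum of the
  \<open>P i\<close>; inserting the constants of \<open>tau_eq\<close> and dividing by a nonzero
  value of B gives the identity. It is what rewrites the term 1/2 of the Ricci tensor on p.\<close>

lemma sum_dim: "(\<Sum>i\<in>{1..m}. 2 * real (dim (ks i)) * (1 - \<kappa> i)) = real (dim p)"
proof -
  obtain y where y: "y \<in> p" "y \<noteq> 0" using noncompact subspace_0[OF sub_p] by blast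
  have pos: "KF y y > 0" using p_posdef y by blast
  have "KF y y = tau kproj y y"
  proof -
    have "trace_on p (\<lambda>X. br y (kproj (br y X))) = trace_on p (\<lambda>X. br y (br y X))"
      using y br_pp by (intro trace_on_cong[OF sub_p]) (simp add: kproj_k)
    then show ?thesis using killing_split_p[OF y(1) y(1)] by (simp add: tau_def)
  qed
  also have "kproj = (\<lambda>X. \<Sum>i\<in>{1..m}. 1 *\<^sub>R P i X)" by (rule ext) (simp only: kproj_sum scaleR_one)
  also have "tau \<dots> y y = (\<Sum>i\<in>{1..m}. 1 * tau (P i) y y)" by (rule tau_combination)
  also have "\<dots> = (\<Sum>i\<in>{1..m}. 2 * real (dim (ks i)) * (1 - \<kappa> i) / real (dim p) * KF y y)"
    using tau_eq y by (intro sum.cong) auto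
  also have "\<dots> = (\<Sum>i\<in>{1..m}. 2 * real (dim (ks i)) * (1 - \<kappa> i)) / real (dim p) * KF y y"
    by (simp add: sum_distrib_right sum_divide_distrib)
  finally have "KF y y = (\<Sum>i\<in>{1..m}. 2 * real (dim (ks i)) * (1 - \<kappa> i)) / real (dim p) * KF y y" .
  then show ?thesis unfolding mult_cancel_right1 divide_eq_1_iff using pos by auto
qed

subsection \<open>The Ricci tensor of an invariant metric\<close>

text \<open>The coefficients may have any sign, so metrics, their Ricci tensors and the prescribed
  tensor all belong to one family and the equation becomes a comparison of coefficients.\<close>

definition kmet :: "real \<Rightarrow> (nat \<Rightarrow> real) \<Rightarrow> 'v \<Rightarrow> 'v \<Rightarrow> real" where
  "kmet \<beta> \<alpha> = (\<lambda>X Y. \<beta> * restr Q p X Y + (\<Sum>i\<in>{1..m}. \<alpha> i * restr Q (ks i) X Y))"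

lemma restr_p: "restr Q p X Y = KF (pproj X) (pproj Y)"
  by (simp add: restr_def qproj_p Q_p pproj_in)

lemma restr_ks: "i \<in> {1..m} \<Longrightarrow> restr Q (ks i) X Y = - KF (P i X) (P i Y)"
  by (simp add: restr_def Q_k P_k)

lemma ricci_kmet:
  assumes \<beta>: "\<beta> > 0" and \<alpha>: "\<And>i. i \<in> {1..m} \<Longrightarrow> \<alpha> i > 0"
  shows "ricci br (kmet \<beta> \<alpha>) = kmet
     (- (1/2 + (\<Sum>i\<in>{1..m}. \<alpha> i / \<beta> * real (dim (ks i)) * (1 - \<kappa> i)) / (2 * real (dim p))))
     (\<lambda>i. (\<kappa> i + (\<alpha> i / \<beta>)\<^sup>2 * (1 - \<kappa> i)) / 4)"
proof -
  define l where "l i = \<alpha> i / \<beta>" for i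
  have l: "i \<in> {1..m} \<Longrightarrow> l i > 0" for i using assms by (simp add: l_def)
  \<comment> \<open>Only the ratios \<alpha>/\<beta> enter, in accordance with the invariance of the
    Ricci tensor under scaling of the metric.\<close>
  define L where "L X = (\<Sum>i\<in>{1..m}. l i *\<^sub>R P i X)" for X
  have Qnn: "Q z z \<ge> 0" for z using Q_pos[of z] by (cases "z = 0") (auto simp: Q.zero_left)
  have QL: "Q (L X) Y = (\<Sum>i\<in>{1..m}. l i * Q (P i X) (P i Y))" for X Y
    unfolding L_def Q.sum_left Q.scaleR_left using P_sym2 by (intro sum.cong) auto
  interpret M: cartan_metric br k p L \<beta>
  proof (intro cartan_metric.intro cartan_metric_axioms.intro cartan_axioms)
    show "linear L"
      unfolding L_def[abs_def] by (intro linear_compose_sum ballI linear_compose_scale_right linear_P)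
    show "L X \<in> k" for X unfolding L_def by (intro subspace_sum subspace_mul sub_k P_k)
    show "L X = 0" if "X \<in> p" for X using P_p that by (simp add: L_def)
    show "Q (L X) Y = Q X (L Y)" for X Y
    proof -
      have "Q X (L Y) = Q (L Y) X" by (rule Q.sym)
      also have "\<dots> = Q (L X) Y" unfolding QL by (intro sum.cong refl arg_cong2[where f="(*)"] Q.sym)
      finally show ?thesis by simp
    qed
    show "L (br U X) = br U (L X)" if "U \<in> k" for U X
      unfolding L_def br.sum_right br.scaleR_right using P_br that by (intro sum.cong) auto
    show "\<beta> > 0" by (rule \<beta>)
    show "Q (L X) X > 0" if X: "X \<in> k" "X \<noteq> 0" for X
    proof -
      have "\<exists>i\<in>{1..m}. P i X \<noteq> 0"
        using X kproj_sum[of X] kproj_k[OF X(1)] by (metis (no_types, lifting) sum.neutral)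
      then obtain i where "i \<in> {1..m}" "P i X \<noteq> 0" by blast
      then show ?thesis unfolding QL
        using l Q_pos Qnn by (intro sum_pos2[of _ i]) (auto intro!: mult_nonneg_nonneg less_imp_le[OF l])
    qed
  qed
  have metric: "M.met = kmet \<beta> \<alpha>"
  proof (intro ext)
    fix X Y
    have "\<beta> * Q (L X) Y = (\<Sum>i\<in>{1..m}. \<alpha> i * restr Q (ks i) X Y)"
      unfolding QL sum_distrib_left using \<beta> by (intro sum.cong) (auto simp: l_def restr_def)
    then show "M.met X Y = kmet \<beta> \<alpha> X Y"
      by (simp add: M.met_def kmet_def distrib_left restr_def qproj_p)
  qed
  show ?thesis
  proof (intro ext)
    fix Y Z
    have PL: "P i (L X) = l i *\<^sub>R P i X" if i: "i \<in> {1..m}" for i X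
    proof -
      have "P i (L X) = (\<Sum>j\<in>{1..m}. P i (l j *\<^sub>R P j X))"
        unfolding L_def by (rule linear_sum[OF linear_P[OF i]])
      also have "\<dots> = (\<Sum>j\<in>{1..m}. if j = i then l i *\<^sub>R P i X else 0)"
        using P_other[OF i] P_in P_ident[OF i]
        by (intro sum.cong) (auto simp: linear_cmul[OF linear_P[OF i]])
      finally show ?thesis using i by simp
    qed
    have Pk: "P i (kproj X) = P i X" if i: "i \<in> {1..m}" for i X
    proof -
      have "P i X = P i (kproj X + pproj X)" by (simp flip: split)
      then show ?thesis using P_p[OF i] pproj_in by (simp add: linear_add[OF linear_P[OF i]])
    qed
    have 1: "killing_on br k (kproj Y) (kproj Z) = (\<Sum>i\<in>{1..m}. \<kappa> i * KF (P i Y) (P i Z))"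
      unfolding killing_on_k_diagonal[OF kproj_in kproj_in] using Pk by (intro sum.cong) auto
    have 2: "killing_on br p (L Y) (L Z) = (\<Sum>i\<in>{1..m}. (l i)\<^sup>2 * (1 - \<kappa> i) * KF (P i Y) (P i Z))"
      unfolding killing_on_p_diagonal[OF M.L_in M.L_in] using PL
      by (intro sum.cong) (auto simp: B.scaleR_left B.scaleR_right power2_eq_square)
    have 3: "tau L (pproj Y) (pproj Z) =
        (\<Sum>i\<in>{1..m}. l i * real (dim (ks i)) * (1 - \<kappa> i)) * 2 / real (dim p) * KF (pproj Y) (pproj Z)"
      unfolding L_def[abs_def] tau_combination sum_distrib_right sum_divide_distrib
      using tau_eq pproj_in by (intro sum.cong) (auto simp: mult_ac)
    have 4: "(\<Sum>i\<in>{1..m}. (\<kappa> i + (l i)\<^sup>2 * (1 - \<kappa> i)) / 4 * restr Q (ks i) Y Z)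
        = - (\<Sum>i\<in>{1..m}. \<kappa> i * KF (P i Y) (P i Z)) / 4
          - (\<Sum>i\<in>{1..m}. (l i)\<^sup>2 * (1 - \<kappa> i) * KF (P i Y) (P i Z)) / 4"
      unfolding sum_divide_distrib sum_negf[symmetric] sum_subtractf[symmetric]
      by (intro sum.cong) (auto simp: restr_ks field_simps)
    show "ricci br (kmet \<beta> \<alpha>) Y Z = kmet
     (- (1/2 + (\<Sum>i\<in>{1..m}. \<alpha> i / \<beta> * real (dim (ks i)) * (1 - \<kappa> i)) / (2 * real (dim p))))
     (\<lambda>i. (\<kappa> i + (\<alpha> i / \<beta>)\<^sup>2 * (1 - \<kappa> i)) / 4) Y Z"
      unfolding metric[symmetric] M.ricci_met 1 2 3 
      unfolding kmet_def l_def[symmetric] 4 restr_p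
      using dim_p_pos by (simp add: field_simps)
  qed
qed

text \<open>At a nonzero vector of p or of \<open>ks i\<close> exactly one summand survives, and B
  does not vanish there.\<close>

lemma kmet_inject:
  assumes eq: "kmet b a = kmet b' a'"
  shows "b = b'" "i \<in> {1..m} \<Longrightarrow> a i = a' i"
proof -
  obtain y where y: "y \<in> p" "y \<noteq> 0" using noncompact subspace_0[OF sub_p] by blast
  have "kmet b a y y = b * KF y y" for b a
    using y by (simp add: kmet_def restr_p restr_ks P_p B.zero_left pproj_p)
  moreover have "KF y y > 0" using p_posdef y by blast
  ultimately show "b = b'" using fun_cong[OF fun_cong[OF eq], of y y] by simp
  assume i: "i \<in> {1..m}"
  obtain x where x: "x \<in> ks i" "x \<noteq> 0" using ks_nontrivial[OF i] subspace_0[OF sub_ks[OF i]] by blast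
  have xk: "x \<in> k" using x ks_k[OF i] by blast
  have "kmet b a x x = - a i * KF x x" for b a
  proof -
    have "(\<Sum>j\<in>{1..m}. a j * restr Q (ks j) x x) = (\<Sum>j\<in>{1..m}. if j = i then - a i * KF x x else 0)"
      using P_other[OF _ i] x(1) P_ident[OF i x(1)]
      by (intro sum.cong) (auto simp: restr_ks B.zero_left)
    then show ?thesis using i xk by (simp add: kmet_def restr_p pproj_k B.zero_left)
  qed
  moreover have "KF x x < 0" using k_negdef xk x by blast
  ultimately show "a i = a' i" using fun_cong[OF fun_cong[OF eq], of x x] by simp
qed

lemma kmet_cong: "b = b' \<Longrightarrow> (\<And>i. i \<in> {1..m} \<Longrightarrow> a i = a' i) \<Longrightarrow> kmet b a = kmet b' a'"
  by (simp add: kmet_def)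

lemma MK_kmet: "MK br k p ks m = {kmet \<beta> \<alpha> | \<beta> \<alpha>. \<beta> > 0 \<and> (\<forall>i\<in>{1..m}. \<alpha> i > 0)}"
  by (simp add: MK_def kmet_def)

text \<open>Solving for \<alpha> in terms of \<beta> makes the equivalence serve twice: right to
  left it yields a solution, left to right it shows that \<beta> is the only freedom.\<close>

lemma ricci_kmet_iff:
  assumes \<beta>: "\<beta> > 0" and \<alpha>: "\<And>i. i \<in> {1..m} \<Longrightarrow> \<alpha> i > 0"
  shows "ricci br (kmet \<beta> \<alpha>) = kmet (- Tp) T \<longleftrightarrow>
    Tp = (\<Sum>i\<in>{1..m}. (2 * real (dim (ks i)) * (1 - \<kappa> i)
        + real (dim (ks i)) * sqrt ((4 * T i - \<kappa> i) * (1 - \<kappa> i))) / (2 * real (dim p)))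
    \<and> (\<forall>i\<in>{1..m}. 4 * T i - \<kappa> i > 0 \<and> \<alpha> i = \<beta> * sqrt ((4 * T i - \<kappa> i) / (1 - \<kappa> i)))"
proof -
  have *: "(\<kappa> i + (\<alpha> i / \<beta>)\<^sup>2 * (1 - \<kappa> i)) / 4 = T i \<longleftrightarrow>
      4 * T i - \<kappa> i > 0 \<and> \<alpha> i = \<beta> * sqrt ((4 * T i - \<kappa> i) / (1 - \<kappa> i))" if i: "i \<in> {1..m}" for i
  proof -
    have k1: "1 - \<kappa> i > 0" using kappa_less_1[OF i] by simp
    have pos: "\<alpha> i / \<beta> > 0" using \<alpha>[OF i] \<beta> by simp
    have "(\<kappa> i + (\<alpha> i / \<beta>)\<^sup>2 * (1 - \<kappa> i)) / 4 = T i \<longleftrightarrow> (\<alpha> i / \<beta>)\<^sup>2 = (4 * T i - \<kappa> i) / (1 - \<kappa> i)"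
      using k1 by (auto simp: eq_divide_eq)
    \<comment> \<open>Positivity of \<alpha>/\<beta> selects the positive root, and also forces the
      quotient under the root to be positive.\<close>
    also have "\<dots> \<longleftrightarrow> (4 * T i - \<kappa> i) / (1 - \<kappa> i) > 0 \<and> \<alpha> i / \<beta> = sqrt ((4 * T i - \<kappa> i) / (1 - \<kappa> i))"
      using pos by (metis less_imp_le real_sqrt_pow2 real_sqrt_unique zero_less_power)
    also have "\<dots> \<longleftrightarrow> 4 * T i - \<kappa> i > 0 \<and> \<alpha> i = \<beta> * sqrt ((4 * T i - \<kappa> i) / (1 - \<kappa> i))"
      using k1 \<beta> by (simp add: zero_less_divide_iff divide_eq_eq mult.commute)
    finally show ?thesis .
  qed
  let ?S = "\<Sum>i\<in>{1..m}. \<alpha> i / \<beta> * real (dim (ks i)) * (1 - \<kappa> i)"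
  have R: "ricci br (kmet \<beta> \<alpha>) = kmet (- (1/2 + ?S / (2 * real (dim p))))
      (\<lambda>i. (\<kappa> i + (\<alpha> i / \<beta>)\<^sup>2 * (1 - \<kappa> i)) / 4)"
    by (rule ricci_kmet[OF assms])
  have "ricci br (kmet \<beta> \<alpha>) = kmet (- Tp) T \<longleftrightarrow>
      Tp = 1/2 + ?S / (2 * real (dim p)) \<and> (\<forall>i\<in>{1..m}. (\<kappa> i + (\<alpha> i / \<beta>)\<^sup>2 * (1 - \<kappa> i)) / 4 = T i)"
    unfolding R
  proof
    assume eq: "kmet (- (1/2 + ?S / (2 * real (dim p)))) (\<lambda>i. (\<kappa> i + (\<alpha> i / \<beta>)\<^sup>2 * (1 - \<kappa> i)) / 4) = kmet (- Tp) T"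
    show "Tp = 1/2 + ?S / (2 * real (dim p)) \<and> (\<forall>i\<in>{1..m}. (\<kappa> i + (\<alpha> i / \<beta>)\<^sup>2 * (1 - \<kappa> i)) / 4 = T i)"
      using kmet_inject(1)[OF eq] kmet_inject(2)[OF eq] by (intro conjI ballI, linarith, blast)
  qed (intro kmet_cong, auto)
  also have "\<dots> \<longleftrightarrow> Tp = 1/2 + ?S / (2 * real (dim p)) \<and>
     (\<forall>i\<in>{1..m}. 4 * T i - \<kappa> i > 0 \<and> \<alpha> i = \<beta> * sqrt ((4 * T i - \<kappa> i) / (1 - \<kappa> i)))"
    using * by simp
  also have "\<dots> \<longleftrightarrow> Tp = (\<Sum>i\<in>{1..m}. (2 * real (dim (ks i)) * (1 - \<kappa> i)
        + real (dim (ks i)) * sqrt ((4 * T i - \<kappa> i) * (1 - \<kappa> i))) / (2 * real (dim p))) \<and>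
     (\<forall>i\<in>{1..m}. 4 * T i - \<kappa> i > 0 \<and> \<alpha> i = \<beta> * sqrt ((4 * T i - \<kappa> i) / (1 - \<kappa> i)))"
  proof -
    \<comment> \<open>Both versions of the equation for \<open>Tp\<close> stand in conjunction with
      the conditions on the k_i, so their right sides need to agree only under those
      conditions.\<close>
    have "1/2 + ?S / (2 * real (dim p)) = (\<Sum>i\<in>{1..m}. (2 * real (dim (ks i)) * (1 - \<kappa> i)
        + real (dim (ks i)) * sqrt ((4 * T i - \<kappa> i) * (1 - \<kappa> i))) / (2 * real (dim p)))"
      if C: "\<forall>i\<in>{1..m}. 4 * T i - \<kappa> i > 0 \<and> \<alpha> i = \<beta> * sqrt ((4 * T i - \<kappa> i) / (1 - \<kappa> i))"
    proof -
      have "\<alpha> i / \<beta> * real (dim (ks i)) * (1 - \<kappa> i) = real (dim (ks i)) * sqrt ((4 * T i - \<kappa> i) * (1 - \<kappa> i))"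
        if i: "i \<in> {1..m}" for i
      proof -
        \<comment> \<open>Writing 1 - \<kappa> as the square of its root cancels the denominator:
          sqrt(a/c) c = sqrt(a c), valid because c = 1 - \<kappa> is positive.\<close>
        have "\<alpha> i / \<beta> * (1 - \<kappa> i) = sqrt ((4 * T i - \<kappa> i) / (1 - \<kappa> i)) * (sqrt (1 - \<kappa> i) * sqrt (1 - \<kappa> i))"
          using C i \<beta> kappa_less_1[OF i] by simp
        also have "\<dots> = sqrt ((4 * T i - \<kappa> i) * (1 - \<kappa> i))"
          using kappa_less_1[OF i] by (simp add: real_sqrt_divide real_sqrt_mult del: real_sqrt_mult_self)
        finally have e: "\<alpha> i / \<beta> * (1 - \<kappa> i) = sqrt ((4 * T i - \<kappa> i) * (1 - \<kappa> i))" .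
        have "\<alpha> i / \<beta> * real (dim (ks i)) * (1 - \<kappa> i) = real (dim (ks i)) * (\<alpha> i / \<beta> * (1 - \<kappa> i))"
          by simp
        then show ?thesis by (simp only: e)
      qed
      then have S: "?S = (\<Sum>i\<in>{1..m}. real (dim (ks i)) * sqrt ((4 * T i - \<kappa> i) * (1 - \<kappa> i)))"
        by (intro sum.cong) auto
      have "1/2 + a / (2 * n) = (n + a) / (2 * n)" if "n > 0" for a n :: real
        using that by (simp add: field_simps)
      from this[of "real (dim p)"] have "1/2 + ?S / (2 * real (dim p)) = (real (dim p) + ?S) / (2 * real (dim p))"
        using dim_p_pos by (simp only: of_nat_0_less_iff)
      then show ?thesis
        by (simp only: S flip: sum_dim sum.distrib sum_divide_distrib)
    qed
    then show ?thesis by (metis (no_types, lifting))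
  qed
  finally show ?thesis .
qed

end

section \<open>Simple ideals of the compact part\<close>

context cartan
begin

section \<open>Ideals of k and the splitting into derived algebra and centre\<close>

abbreviation "h \<equiv> derived br k"
abbreviation "k_ideal I \<equiv> ideal_of br k I"

lemma br_swap_in: "subspace I \<Longrightarrow> br x y \<in> I \<Longrightarrow> br y x \<in> I"
  by (subst br_anti) (rule subspace_neg)

lemma derived_in: "x \<in> a \<Longrightarrow> y \<in> a \<Longrightarrow> br x y \<in> derived br a"
  unfolding derived_def by (intro span_base) auto

lemma derived_subset: "subspace I \<Longrightarrow> (\<And>x y. x \<in> a \<Longrightarrow> y \<in> a \<Longrightarrow> br x y \<in> I) \<Longrightarrow> derived br a \<subseteq> I"
  unfolding derived_def by (intro span_minimal) auto

lemma h_k: "h \<subseteq> k"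
  by (intro derived_subset sub_k br_kk)

lemma sub_h: "subspace h"
  by (simp add: derived_def)

lemma k_ideal_h: "k_ideal h"
  using sub_h h_k derived_in unfolding ideal_of_def by blast

lemma k_idealD:
  assumes "k_ideal I"
  shows "subspace I" "I \<subseteq> k" "\<And>u x. u \<in> k \<Longrightarrow> x \<in> I \<Longrightarrow> br u x \<in> I" "\<And>u x. u \<in> k \<Longrightarrow> x \<in> I \<Longrightarrow> br x u \<in> I"
  using assms br_swap_in by (auto simp: ideal_of_def)

lemma k_zeroI:
  assumes "x \<in> k" "KF x x = 0" shows "x = 0"
  using assms k_negdef by force

text \<open>B([u,x],[u,x]) = B(u,[x,[u,x]]), where the last bracket lies in \<open>I\<close>. Thus
  the orthogonal complement of an ideal acts trivially on it.\<close>

lemma k_ideal_orth_comm: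
  assumes I: "k_ideal I" and u: "u \<in> k" "\<And>w. w \<in> I \<Longrightarrow> KF u w = 0" and x: "x \<in> I"
  shows "br u x = 0"
proof (rule k_zeroI)
  note I = k_idealD[OF I]
  show "br u x \<in> k" using I u x by blast
  have "br x (br u x) \<in> I" using I u x by blast
  then show "KF (br u x) (br u x) = 0" using killing_inv[of u x "br u x"] u by simp
qed

lemma k_ideal_centre: "k_ideal (centre br k)"
proof -
  have "br u z = 0" if "u \<in> k" "z \<in> centre br k" for u z
    using that br_anti[of u z] by (simp add: centre_def)
  then show ?thesis using sub_k
    by (auto simp: ideal_of_def centre_def subspace_def br.zero_left br.add_left br.scaleR_left)
qed

lemma centre_derived_orth:
  assumes z: "z \<in> centre br k" and x: "x \<in> h" shows "KF z x = 0"
proof -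
  have "subspace {x. KF z x = 0}"
    by (auto simp: subspace_def B.zero_right B.add_right B.scaleR_right)
  moreover have "KF z (br a b) = 0" if "a \<in> k" "b \<in> k" for a b
    using killing_inv[of z a b] z that by (simp add: centre_def B.zero_left)
  ultimately have "h \<subseteq> {x. KF z x = 0}" by (intro derived_subset) auto
  then show ?thesis using x by blast
qed

text \<open>For z orthogonal to [k,k], B([z,a],[z,a]) = B(z,[a,[z,a]]) = 0, so z is central. Hence k
  is the sum of [k,k] and its centre.\<close>

lemma derived_centre_sum:
  assumes x: "x \<in> k" shows "x - qproj Q h x \<in> centre br k"
proof -
  let ?z = "x - qproj Q h x"
  have "qproj Q h x \<in> k" using Q.qproj_in[OF sub_h Q_pos] h_k by blast
  then have z: "?z \<in> k" using x sub_k by (simp add: subspace_diff)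
  have "KF ?z w = 0" if w: "w \<in> h" for w
    using Q.qproj_orth[OF sub_h Q_pos w, of x] Q_k(1)[OF z, of w] by simp
  then have "br ?z a = 0" if a: "a \<in> k" for a
    using derived_in[OF a] z a br_kk killing_inv[of ?z a "br ?z a"]
    by (intro k_zeroI) auto
  then show ?thesis using z by (simp add: centre_def)
qed

text \<open>By \<open>derived_centre_sum\<close> an element of k acts on [k,k] as its projection
  does, since the central part acts by zero. This translates the ideals of the theorem into ideals
  of k.\<close>

lemma h_ideal_iff: "ideal_of br h I \<longleftrightarrow> k_ideal I \<and> I \<subseteq> h"
proof
  assume I: "ideal_of br h I"
  then have s: "subspace I" "I \<subseteq> h" by (auto simp: ideal_of_def)
  have "br u x \<in> I" if u: "u \<in> k" and x: "x \<in> I" for u x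
  proof -
    have "br (u - qproj Q h u) x = 0"
      using derived_centre_sum[OF u] x s h_k by (auto simp: centre_def)
    then have "br u x = br (qproj Q h u) x" by (simp add: br.diff_left)
    moreover have "qproj Q h u \<in> h" by (rule Q.qproj_in[OF sub_h Q_pos])
    ultimately show ?thesis using I x by (simp add: ideal_of_def)
  qed
  then show "k_ideal I \<and> I \<subseteq> h" using s h_k by (auto simp: ideal_of_def)
next
  assume "k_ideal I \<and> I \<subseteq> h"
  then show "ideal_of br h I" using h_k by (auto simp: ideal_of_def)
qed

lemma orth_split:
  assumes I: "k_ideal I" and u: "u \<in> k" and x: "x \<in> I"
  shows "br u x = br (qproj Q I u) x"
proof -
  note I' = k_idealD[OF I]
  have "qproj Q I u \<in> k" using Q.qproj_in[OF I'(1) Q_pos] I'(2) by blast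
  then have k: "u - qproj Q I u \<in> k" using u sub_k by (simp add: subspace_diff)
  have "KF (u - qproj Q I u) w = 0" if "w \<in> I" for w
    using Q.qproj_orth[OF I'(1) Q_pos that, of u] Q_k(1)[OF k, of w] by simp
  then have "br (u - qproj Q I u) x = 0" by (rule k_ideal_orth_comm[OF I k _ x])
  then show ?thesis by (simp add: br.diff_left)
qed

text \<open>The action of k on \<open>I\<close> factors through the orthogonal projection to
  \<open>I\<close> (\<open>orth_split\<close>), which preserves \<open>J\<close>.\<close>

lemma ideal_of_ideal:
  assumes I: "k_ideal I" and J: "ideal_of br I J" shows "k_ideal J"
proof -
  have "br u x \<in> J" if u: "u \<in> k" and x: "x \<in> J" for u x
    using orth_split[OF I u, of x] x J Q.qproj_in[OF k_idealD(1)[OF I] Q_pos, of u]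
    by (auto simp: ideal_of_def)
  then show ?thesis using J k_idealD(2)[OF I] by (auto simp: ideal_of_def)
qed

text \<open>Minimality excludes proper ideals by \<open>ideal_of_ideal\<close>. If \<open>I\<close>
  were abelian, \<open>orth_split\<close> would make it central in k, while the centre is orthogonal
  to [k,k] and B is definite.\<close>

lemma minimal_ideal_simple:
  assumes I: "k_ideal I" "I \<subseteq> h" "I \<noteq> {0}"
    and min: "\<And>J. k_ideal J \<Longrightarrow> J \<subseteq> I \<Longrightarrow> J = {0} \<or> J = I"
  shows "simple_alg br I"
proof -
  note I' = k_idealD[OF I(1)]
  have "\<exists>x\<in>I. \<exists>y\<in>I. br x y \<noteq> 0"
  proof (rule ccontr)
    assume "\<not> (\<exists>x\<in>I. \<exists>y\<in>I. br x y \<noteq> 0)"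
    then have ab: "\<And>x y. x \<in> I \<Longrightarrow> y \<in> I \<Longrightarrow> br x y = 0" by blast
    have "x = 0" if x: "x \<in> I" for x
    proof (rule k_zeroI)
      show "x \<in> k" using x I' by blast
      have "br u x = 0" if "u \<in> k" for u
        using orth_split[OF I(1) that x] ab[OF Q.qproj_in[OF I'(1) Q_pos] x] by simp
      then have "br x u = 0" if "u \<in> k" for u using that br_anti[of x u] by simp
      then have "x \<in> centre br k" using x I' by (auto simp: centre_def)
      then show "KF x x = 0" using centre_derived_orth x I(2) by blast
    qed
    then show False using I(3) subspace_0[OF I'(1)] by blast
  qed
  moreover have "subalg br I" using I' by (auto simp: subalg_def)
  moreover have "J = {0} \<or> J = I" if "ideal_of br I J" for J
    using ideal_of_ideal[OF I(1) that] min that by (auto simp: ideal_of_def)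
  ultimately show ?thesis by (auto simp: simple_alg_def)
qed

section \<open>Decomposition into simple ideals and their Killing constants\<close>

abbreviation "simple_ideals \<equiv> {I. ideal_of br h I \<and> simple_alg br I}"

text \<open>Induction on dimension: an ideal that is neither zero nor simple contains a proper
  nonzero ideal \<open>J\<close>; the orthogonal complement \<open>J2\<close> of \<open>J\<close> in
  \<open>I\<close> is again an ideal, and both are smaller than \<open>I\<close>.\<close>

lemma ideal_span_simple:
  assumes "k_ideal I" "I \<subseteq> h"
  shows "I \<subseteq> span (\<Union>simple_ideals)"
  using assms
proof (induction "dim I" arbitrary: I rule: less_induct)
  case less
  note I' = k_idealD[OF less.prems(1)]
  consider "I = {0}" | "simple_alg br I" | J where "k_ideal J" "J \<subseteq> I" "J \<noteq> {0}" "J \<noteq> I"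
    using minimal_ideal_simple[OF less.prems] by blast
  then show ?case
  proof cases
    case 1
    then show ?thesis by (simp add: span_zero)
  next
    case 2
    then have "I \<in> simple_ideals" using less.prems by (simp add: h_ideal_iff)
    then have "I \<subseteq> \<Union>simple_ideals" by blast
    then show ?thesis using span_superset by (rule order_trans)
  next
    case (3 J)
    note J' = k_idealD[OF 3(1)]
    define J2 where "J2 = {x\<in>I. \<forall>w\<in>J. Q x w = 0}"
    have sJ2: "subspace J2"
      using I'(1) by (auto simp: J2_def subspace_def Q.zero_left Q.add_left Q.scaleR_left)
    have iJ2: "k_ideal J2"
      using sJ2 I' J'(3) by (auto simp: ideal_of_def J2_def Q_skew)
    have "J2 \<noteq> I"
    proof
      assume eq: "J2 = I"
      obtain j where j: "j \<in> J" "j \<noteq> 0" using 3(3) subspace_0[OF J'(1)] by blast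
      then have "Q j j = 0" using eq 3(2) by (auto simp: J2_def)
      then show False using Q_pos[OF j(2)] by simp
    qed
    then have "J \<subset> I" "J2 \<subset> I" using 3 by (auto simp: J2_def)
    then have d: "dim J < dim I" "dim J2 < dim I"
      using J'(1) sJ2 I'(1) by (simp_all only: dim_psubset span_eq_iff[THEN iffD2])
    have sp: "J \<subseteq> span (\<Union>simple_ideals)" "J2 \<subseteq> span (\<Union>simple_ideals)"
      using less.hyps[OF d(1) 3(1)] less.hyps[OF d(2) iJ2] 3(2) less.prems(2) by (auto simp: J2_def)
    show ?thesis
    proof
      fix x assume x: "x \<in> I"
      have q: "qproj Q J x \<in> J" by (rule Q.qproj_in[OF J'(1) Q_pos])
      then have "x - qproj Q J x \<in> I" using x 3(2) I'(1) by (auto intro: subspace_diff)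
      moreover have "Q (x - qproj Q J x) w = 0" if "w \<in> J" for w
        by (rule Q.qproj_orth[OF J'(1) Q_pos that])
      ultimately have "x - qproj Q J x \<in> J2" by (simp add: J2_def)
      then have "qproj Q J x + (x - qproj Q J x) \<in> span (\<Union>simple_ideals)"
        using q sp by (intro span_add) auto
      then show "x \<in> span (\<Union>simple_ideals)" by simp
    qed
  qed
qed

lemma k_span_simple: "k \<subseteq> span (\<Union>simple_ideals \<union> centre br k)"
proof
  fix x assume x: "x \<in> k"
  have "qproj Q h x \<in> h" by (rule Q.qproj_in[OF sub_h Q_pos])
  then have "qproj Q h x \<in> span (\<Union>simple_ideals)"
    using ideal_span_simple[OF k_ideal_h] by blast
  then have "qproj Q h x \<in> span (\<Union>simple_ideals \<union> centre br k)"
    using span_mono[of "\<Union>simple_ideals" "\<Union>simple_ideals \<union> centre br k"] by blast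
  moreover have "x - qproj Q h x \<in> span (\<Union>simple_ideals \<union> centre br k)"
    using derived_centre_sum[OF x] by (intro span_base) blast
  ultimately have "qproj Q h x + (x - qproj Q h x) \<in> span (\<Union>simple_ideals \<union> centre br k)"
    by (rule span_add)
  then show "x \<in> span (\<Union>simple_ideals \<union> centre br k)" by simp
qed

text \<open>Distinct simple ideals meet in zero and hence commute. Since \<open>I\<close> is its own
  derived algebra, B([a,b],y) = B(a,[b,y]) = 0 settles all of \<open>I\<close>.\<close>

lemma simple_ideals_orth:
  assumes I: "I \<in> simple_ideals" and J: "J \<in> simple_ideals" and ne: "I \<noteq> J" and x: "x \<in> I" and y: "y \<in> J"
  shows "KF x y = 0"
proof -
  have kI: "k_ideal I" "k_ideal J" "simple_alg br I" "simple_alg br J" using I J by (auto simp: h_ideal_iff)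
  note I' = k_idealD[OF kI(1)] and J' = k_idealD[OF kI(2)]
  have s: "subspace (I \<inter> J)" using I' J' by (simp add: subspace_inter)
  have "ideal_of br I (I \<inter> J)" "ideal_of br J (I \<inter> J)"
    using s I'(3) J'(3) subsetD[OF I'(2)] subsetD[OF J'(2)] by (auto simp: ideal_of_def)
  then have IJ: "I \<inter> J = {0}" using kI ne unfolding simple_alg_def by blast
  have comm: "br b z = 0" if "b \<in> I" "z \<in> J" for b z
  proof -
    have "br b z \<in> I" "br b z \<in> J" using that I'(4)[of z b] J'(3)[of b z] I'(2) J'(2) by auto
    then show ?thesis using IJ by blast
  qed
  have "derived br I \<subseteq> I" using I' by (intro derived_subset) auto
  then have "ideal_of br I (derived br I)"
    using derived_in by (auto simp: ideal_of_def derived_def)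
  moreover have "derived br I \<noteq> {0}" using kI(3) derived_in[of _ I] unfolding simple_alg_def by blast
  ultimately have eq: "derived br I = I" using kI(3) unfolding simple_alg_def by blast
  have "derived br I \<subseteq> {x. KF x y = 0}"
    using comm[OF _ y] by (intro derived_subset)
      (auto simp: subspace_def B.zero_left B.zero_right B.add_left B.scaleR_left killing_inv)
  then show ?thesis using eq x by blast
qed

lemma simple_ideal_nontrivial: "simple_alg br I \<Longrightarrow> I \<noteq> {0}"
  by (auto simp: simple_alg_def br.zero_left)

text \<open>The operator maps k into \<open>I\<close>, so its trace over k is its trace over
  \<open>I\<close>. This connects \<open>kappa\<close>, defined by the Killing form of the ideal,
  with the Killing form of k used in \<open>cartan_decomp\<close>.\<close>

lemma killing_on_ideal:
  assumes I: "k_ideal I" and x: "x \<in> I" and y: "y \<in> I"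
  shows "killing_on br I x y = killing_on br k x y"
proof -
  note I' = k_idealD[OF I]
  have "trace_on k (\<lambda>W. br x (br y W)) = trace_on I (\<lambda>W. br x (br y W))"
    using trace_on_commute[OF sub_k I'(1) linear_ad2[of x y] linear_ident] x y I' by blast
  then show ?thesis by (simp add: killing_on_def)
qed

lemma kappa_eqI:
  assumes S: "S \<subseteq> k" "0 \<in> S" "S \<noteq> {0}" and c: "\<And>x y. x \<in> S \<Longrightarrow> y \<in> S \<Longrightarrow> killing_on br S x y = c * KF x y"
  shows "kappa br S = c"
  unfolding kappa_def
proof (rule some_equality)
  show "\<forall>X\<in>S. \<forall>Y\<in>S. killing_on br S X Y = c * KF X Y" using c by blast
  fix c' assume c': "\<forall>X\<in>S. \<forall>Y\<in>S. killing_on br S X Y = c' * KF X Y"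
  obtain x where x: "x \<in> S" "x \<noteq> 0" using S by blast
  then have "c' * KF x x = c * KF x x" using c c' by force
  moreover have "KF x x \<noteq> 0" using x S k_zeroI by blast
  ultimately show "c' = c" by simp
qed

text \<open>Schur's lemma for the adjoint action of \<open>I\<close> on itself, whose invariant
  subspaces are the ideals of \<open>I\<close>. The multiple of \<open>Q\<close> that it provides
  shows that the choice in \<open>kappa\<close> is successful.\<close>

lemma kappa_simple:
  assumes I: "I \<in> simple_ideals" and x: "x \<in> I" and y: "y \<in> I"
  shows "killing_on br k x y = kappa br I * KF x y"
proof -
  have kI: "k_ideal I" "simple_alg br I" using I by (auto simp: h_ideal_iff)
  note I' = k_idealD[OF kI(1)]
  \<comment> \<open>\<open>killing_on br k\<close> is known to be symmetric for arguments that
    preserve k; projecting to k first makes it a symmetric form on the whole space.\<close>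
  define \<sigma> where "\<sigma> X Y = killing_on br k (kproj X) (kproj Y)" for X Y
  have "bilinear \<sigma>"
    unfolding bilinear_def \<sigma>_def
    by (auto intro!: linearI simp: linear_add[OF linear_kproj] linear_cmul[OF linear_kproj]
        killing_on_add_left killing_on_add_right killing_on_scale_left killing_on_scale_right)
  moreover have "\<sigma> X Y = \<sigma> Y X" for X Y
    unfolding \<sigma>_def using kproj_in br_kk by (intro killing_on_sym sub_k) auto
  ultimately have \<sigma>: "sym_form \<sigma>"
    by (simp add: sym_form_def sym_form_axioms_def bilinear_conv_bounded_bilinear)
  have "\<exists>c. \<forall>x\<in>I. \<forall>y\<in>I. \<sigma> x y = c * Q x y"
  proof (rule schur_symmetric_form[where \<phi> = br and K = I,
        OF Q.sym_form_axioms \<sigma> I'(1) simple_ideal_nontrivial[OF kI(2)] Q_pos])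
    show "Q (br u x) y = - Q x (br u y)" if "u \<in> I" for u x y
      using that I'(2) Q_skew by blast
    show "\<sigma> (br u x) y = - \<sigma> x (br u y)" if "u \<in> I" "x \<in> I" "y \<in> I" for u x y
    proof -
      have k: "u \<in> k" "x \<in> k" "y \<in> k" using that I'(2) by auto
      have "killing_on br k (br x u) y = killing_on br k x (br u y)"
        using k br_kk by (intro killing_on_inv sub_k) auto
      moreover have "killing_on br k (br x u) y = - killing_on br k (br u x) y"
        by (metis br_anti bounded_bilinear.minus_left[OF bounded_bilinear_killing_on])
      ultimately show ?thesis using k by (simp add: \<sigma>_def kproj_k br_kk)
    qed
    show "J = {0} \<or> J = I" if "subspace J" "J \<subseteq> I" "\<And>u x. u \<in> I \<Longrightarrow> x \<in> J \<Longrightarrow> br u x \<in> J" for J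
      using kI(2) that by (simp add: simple_alg_def ideal_of_def)
  qed (use I' in auto)
  then obtain c where c: "\<And>x y. x \<in> I \<Longrightarrow> y \<in> I \<Longrightarrow> killing_on br k x y = c * Q x y"
    unfolding \<sigma>_def using I'(2) kproj_k by (metis subsetD)
  have "\<forall>X\<in>I. \<forall>Y\<in>I. killing_on br I X Y = - c * KF X Y"
    using c I'(2) by (auto simp: killing_on_ideal[OF kI(1)] Q_k)
  then have "\<forall>X\<in>I. \<forall>Y\<in>I. killing_on br I X Y = kappa br I * KF X Y"
    unfolding kappa_def by (rule someI)
  then show ?thesis using x y by (simp add: killing_on_ideal[OF kI(1)])
qed

lemma killing_on_centre:
  assumes "y \<in> centre br k" shows "killing_on br k x y = 0"
proof -
  have "killing_on br k x y = trace_on k (\<lambda>W. 0)"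
    unfolding killing_on_def using assms by (intro trace_on_cong sub_k) (simp add: centre_def br.zero_right)
  then show ?thesis by (simp add: trace_on_zero)
qed

text \<open>On the zero space every constant qualifies and the choice in \<open>kappa\<close> is
  unspecified; a nonzero central vector, where B does not vanish, pins it to 0.\<close>

lemma kappa_centre:
  assumes "centre br k \<noteq> {0}" shows "kappa br (centre br k) = 0"
  using assms k_idealD(2)[OF k_ideal_centre] subspace_0[OF k_idealD(1)[OF k_ideal_centre]]
  by (intro kappa_eqI) (auto simp: killing_on_ideal[OF k_ideal_centre] killing_on_centre)

end

section \<open>The prescribed Ricci equation: existence, and uniqueness up to scaling\<close>

theorem theorem4p1:
  fixes br :: "'v::euclidean_space \<Rightarrow> 'v \<Rightarrow> 'v"
    and k p :: "'v set" and ks :: "nat \<Rightarrow> 'v set" and r s :: nat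
    and Tp :: real and T :: "nat \<Rightarrow> real"
  assumes lie: "lie_algebra br"
    and simple: "simple_alg br UNIV"
    and k_sub: "subalg br k"
    and k_negdef: "\<forall>X\<in>k. X \<noteq> 0 \<longrightarrow> killing br X X < 0"
    and p_def: "p = {X. \<forall>Y\<in>k. killing br X Y = 0}"
    and p_posdef: "\<forall>X\<in>p. X \<noteq> 0 \<longrightarrow> killing br X X > 0"
    and pp: "\<forall>X\<in>p. \<forall>Y\<in>p. br X Y \<in> k"
    and noncompact: "p \<noteq> {0}"
    and ks_inj: "inj_on ks {1..r}"
    and ks_simple: "ks ` {1..r} = {I. ideal_of br (derived br k) I \<and> simple_alg br I}"
    and s01: "s \<le> 1"
    and s_centre: "s = 1 \<longleftrightarrow> centre br k \<noteq> {0}"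
    and ks_centre: "s = 1 \<longrightarrow> ks (r + 1) = centre br k"
    and Tp_pos: "Tp > 0"
    and T_pos: "\<forall>i\<in>{1..r+s}. T i > 0"
  shows
   "((\<exists>g\<in>MK br k p ks (r + s).
        ricci br g = (\<lambda>X Y. - Tp * restr (Qform br k p) p X Y
              + (\<Sum>i\<in>{1..r+s}. T i * restr (Qform br k p) (ks i) X Y)))
     \<longleftrightarrow>
     ((\<forall>i\<in>{1..r}. 4 * T i - kappa br (ks i) > 0) \<and>
      Tp = (\<Sum>i\<in>{1..r+s}.
              (2 * real (dim (ks i)) * (1 - kappa br (ks i))
               + real (dim (ks i)) * sqrt ((4 * T i - kappa br (ks i)) * (1 - kappa br (ks i))))
              / (2 * real (dim p)))))
    \<and>
    (\<forall>g1\<in>MK br k p ks (r + s). \<forall>g2\<in>MK br k p ks (r + s).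
        ricci br g1 = (\<lambda>X Y. - Tp * restr (Qform br k p) p X Y
              + (\<Sum>i\<in>{1..r+s}. T i * restr (Qform br k p) (ks i) X Y)) \<longrightarrow>
        ricci br g2 = (\<lambda>X Y. - Tp * restr (Qform br k p) p X Y
              + (\<Sum>i\<in>{1..r+s}. T i * restr (Qform br k p) (ks i) X Y)) \<longrightarrow>
        (\<exists>c>0. g2 = (\<lambda>X Y. c * g1 X Y)))"
proof -
  interpret cartan br k p
    using lie simple k_sub k_negdef p_def p_posdef pp noncompact
    by (intro cartan.intro lie_alg.intro cartan_axioms.intro)
  let ?\<kappa> = "\<lambda>i. kappa br (ks i)"
  have ks: "ks i \<in> simple_ideals" if "i \<in> {1..r}" for i
    using ks_simple that by blast
  \<comment> \<open>Since s is at most 1, the only index beyond r is r + 1, and it occurs exactly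
    when the centre is nonzero.\<close>
  have cases: "i \<in> {1..r} \<or> (s = 1 \<and> i = r + 1 \<and> ks i = centre br k \<and> centre br k \<noteq> {0})"
    if "i \<in> {1..r+s}" for i
  proof (cases "i \<le> r")
    case False
    then have "s = 1" "i = r + 1" using that s01 by auto
    then show ?thesis using s_centre ks_centre by auto
  qed (use that in auto)
  have ideal: "k_ideal (ks i)" if "i \<in> {1..r+s}" for i
    using cases[OF that] ks k_ideal_centre by (auto simp: h_ideal_iff)
  interpret cartan_decomp br k p ks "r + s" ?\<kappa>
  proof (intro cartan_decomp.intro cartan_decomp_axioms.intro cartan_axioms)
    fix i assume i: "i \<in> {1..r+s}"
    show "subspace (ks i)" "ks i \<subseteq> k" "\<And>u x. u \<in> k \<Longrightarrow> x \<in> ks i \<Longrightarrow> br u x \<in> ks i"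
      using k_idealD[OF ideal[OF i]] by auto
    show "ks i \<noteq> {0}" using cases[OF i] ks simple_ideal_nontrivial by auto
    show "killing_on br k x y = ?\<kappa> i * KF x y" if "x \<in> ks i" "y \<in> ks i" for x y
      using cases[OF i]
    proof
      assume "i \<in> {1..r}"
      then show ?thesis using kappa_simple ks that by blast
    next
      assume "s = 1 \<and> i = r + 1 \<and> ks i = centre br k \<and> centre br k \<noteq> {0}"
      then have e: "ks i = centre br k" and n: "centre br k \<noteq> {0}" by auto
      show ?thesis using that(2) unfolding e kappa_centre[OF n] by (simp add: killing_on_centre)
    qed
    show "KF x y = 0" if j: "j \<in> {1..r+s}" "i \<noteq> j" and x: "x \<in> ks i" and y: "y \<in> ks j" for j x y
    proof -
      have h: "ks i \<subseteq> h" if "i \<in> {1..r}" for i using ks[OF that] by (simp add: h_ideal_iff)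
      consider "i \<in> {1..r}" "j \<in> {1..r}" | "i \<in> {1..r}" "ks j = centre br k" | "ks i = centre br k" "j \<in> {1..r}"
        using cases[OF i] cases[OF j(1)] j(2) by blast
      then show ?thesis
      proof cases
        case 1
        then have "ks i \<noteq> ks j" using inj_on_eq_iff[OF ks_inj 1] j(2) by simp
        then show ?thesis by (rule simple_ideals_orth[OF ks[OF 1(1)] ks[OF 1(2)] _ x y])
      next
        case 2
        then show ?thesis using centre_derived_orth[of y x] h x y by (subst B.sym) auto
      next
        case 3
        then show ?thesis using centre_derived_orth[of x y] h x y by auto
      qed
    qed
  next
    \<comment> \<open>The zero vector is treated apart: for s = 0 the centre is {0} and no index
      stands for it.\<close>
    have "z \<in> span (\<Union>i\<in>{1..r+s}. ks i)" if z: "z \<in> \<Union>simple_ideals \<union> centre br k" for z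
    proof (cases "z = 0")
      case False
      have "\<exists>i\<in>{1..r+s}. z \<in> ks i"
      proof (cases "z \<in> centre br k")
        case True
        then have "s = 1" using s_centre \<open>z \<noteq> 0\<close> by blast
        then show ?thesis using True ks_centre by (intro bexI[of _ "r+1"]) auto
      next
        case False
        then obtain i where "i \<in> {1..r}" "z \<in> ks i" using z ks_simple by blast
        then show ?thesis by (intro bexI[of _ i]) auto
      qed
      then show ?thesis by (intro span_base) blast
    qed (simp add: span_zero)
    then have "span (\<Union>simple_ideals \<union> centre br k) \<subseteq> span (\<Union>i\<in>{1..r+s}. ks i)"
      by (intro span_minimal) auto
    then show "k \<subseteq> span (\<Union>i\<in>{1..r+s}. ks i)" using k_span_simple by blast
  qed
  have T: "(\<lambda>X Y. - Tp * restr Q p X Y + (\<Sum>i\<in>{1..r+s}. T i * restr Q (ks i) X Y)) = kmet (- Tp) T"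
    by (simp add: kmet_def)
  let ?l = "\<lambda>i. sqrt ((4 * T i - ?\<kappa> i) / (1 - ?\<kappa> i))"
  \<comment> \<open>At the central index \<kappa> = 0, so the condition reads 4 T > 0 and follows
    from positivity of T.\<close>
  have pos: "(\<forall>i\<in>{1..r}. 4 * T i - ?\<kappa> i > 0) \<longleftrightarrow> (\<forall>i\<in>{1..r+s}. 4 * T i - ?\<kappa> i > 0)"
    using cases kappa_centre T_pos by fastforce
  have l_pos: "?l i > 0" if "i \<in> {1..r+s}" "4 * T i - ?\<kappa> i > 0" for i
    using that kappa_less_1[OF that(1)] by simp
  show ?thesis
    unfolding T pos
  proof (intro conjI iffI ballI impI)
    assume "\<exists>g\<in>MK br k p ks (r + s). ricci br g = kmet (- Tp) T"
    then obtain \<beta> \<alpha> where *: "\<beta> > 0" "\<forall>i\<in>{1..r+s}. \<alpha> i > 0" "ricci br (kmet \<beta> \<alpha>) = kmet (- Tp) T"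
      unfolding MK_kmet by blast
    from ricci_kmet_iff[of \<beta> \<alpha> Tp T] * 
    show "Tp = (\<Sum>i\<in>{1..r+s}. (2 * real (dim (ks i)) * (1 - ?\<kappa> i)
        + real (dim (ks i)) * sqrt ((4 * T i - ?\<kappa> i) * (1 - ?\<kappa> i))) / (2 * real (dim p)))"
      "\<And>i. i \<in> {1..r+s} \<Longrightarrow> 4 * T i - ?\<kappa> i > 0"
      by blast+
  next
    assume a: "(\<forall>i\<in>{1..r+s}. 4 * T i - ?\<kappa> i > 0) \<and>
      Tp = (\<Sum>i\<in>{1..r+s}. (2 * real (dim (ks i)) * (1 - ?\<kappa> i)
        + real (dim (ks i)) * sqrt ((4 * T i - ?\<kappa> i) * (1 - ?\<kappa> i))) / (2 * real (dim p)))"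
    \<comment> \<open>By scale invariance \<beta> can be normalised to 1; the other coefficients are
      then the roots dictated by \<open>ricci_kmet_iff\<close>.\<close>
    then have "ricci br (kmet 1 ?l) = kmet (- Tp) T"
      using l_pos by (subst ricci_kmet_iff) auto
    moreover have "kmet 1 ?l \<in> MK br k p ks (r + s)"
      unfolding MK_kmet using a l_pos by (intro CollectI exI[of _ 1] exI[of _ ?l]) auto
    ultimately show "\<exists>g\<in>MK br k p ks (r + s). ricci br g = kmet (- Tp) T" by blast
  next
    fix g1 g2
    assume g: "g1 \<in> MK br k p ks (r + s)" "g2 \<in> MK br k p ks (r + s)"
      "ricci br g1 = kmet (- Tp) T" "ricci br g2 = kmet (- Tp) T"
    \<comment> \<open>Every solution is a positive multiple of the same metric
      \<open>kmet 1 ?l\<close>, so two solutions differ by the quotient of their scales.\<close>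
    have "\<exists>\<beta>>0. g = kmet \<beta> (\<lambda>i. \<beta> * ?l i)"
      if MK: "g \<in> MK br k p ks (r + s)" and ric: "ricci br g = kmet (- Tp) T" for g
    proof -
      obtain \<beta> \<alpha> where *: "g = kmet \<beta> \<alpha>" "\<beta> > 0" "\<forall>i\<in>{1..r+s}. \<alpha> i > 0"
        using MK unfolding MK_kmet by blast
      then have "\<forall>i\<in>{1..r+s}. \<alpha> i = \<beta> * ?l i"
        using ric ricci_kmet_iff[of \<beta> \<alpha> Tp T] by blast
      then have "g = kmet \<beta> (\<lambda>i. \<beta> * ?l i)" unfolding *(1) by (intro kmet_cong) auto
      then show ?thesis using *(2) by blast
    qed
    from this[OF g(1,3)] this[OF g(2,4)] obtain b c
      where bc: "b > 0" "g1 = kmet b (\<lambda>i. b * ?l i)" "c > 0" "g2 = kmet c (\<lambda>i. c * ?l i)"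
      by blast
    have "g2 = (\<lambda>X Y. c / b * g1 X Y)"
      using bc(1) by (simp add: bc(2,4) kmet_def distrib_left sum_distrib_left mult.assoc)
    then show "\<exists>c>0. g2 = (\<lambda>X Y. c * g1 X Y)" using bc(1,3) by (intro exI[of _ "c / b"]) auto
  qed
qed

end
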